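(* Let $\sigma\in S_k$ (with $d\ge k$). Then $$\mathrm{Wg}^{\mathrm{AIII}}(\sigma,d,d^-)=\sum_{p:\sigma\to\emptyset}(-1)^{\ell_0(p)}(d^-)^{\ell_1(p)}\,d^{-\ell(p)},$$ where the sum runs over all paths $p$ from $\sigma$ to $\emptyset$ in the A III Weingarten graph.
   Context: Let $a,b$ be positive integers, $d=a+b$, $d^-=a-b$, $I'_{ab}=\mathrm{diag}(1,\dots,1,-1,\dots,-1)$ ($a$ ones, $b$ minus ones). Let $\tilde{\mathbb{S}}=\{gI'_{ab}g^*:g\in\mathrm{U}(d)\}$ with probability measure $\nu$ the pushforward of Haar measure on $\mathrm{U}(d)$ under $g\mapsto gI'_{ab}g^*$; $s_{ij}$ are matrix entries. For $d\ge k$ and $\sigma\in S_k$, $\mathrm{Wg}^{\mathrm{AIII}}(\sigma,d,d^-)=\int_{\tilde{\mathbb{S}}}s_{1\sigma(1)}\cdots s_{k\sigma(k)}\,d\nu$. The A III Weingarten graph has vertex set $\bigsqcup_{k\ge0}S_k$ ($S_0=\{\emptyset\}$) and three kinds of arrows: a solid arrow $\sigma\to(i,k)\sigma$ for $\sigma\in S_k$, $k\ge2$, $1\le i<k$; a dashed arrow $\sigma\dashrightarrow\sigma^{\downarrow}$ if $\sigma\in S_k$, $\sigma(k)=k$, where $\sigma^{\downarrow}\in S_{k-1}$ is the restriction to $\{1,\dots,k-1\}$; and a squiggled arrow $\sigma\rightsquigarrow\sigma^{\flat}$ if $\sigma\in S_k$, $k\ge2$, $\sigma(k)=r\ne k$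 and $\sigma(r)=k$, where $\sigma^{\flat}=\iota_r\circ\sigma|_T\circ\iota_r^{-1}\in S_{k-2}$ with $T=\{1,\dots,k-1\}\setminus\{r\}$ and $\iota_r:T\to\{1,\dots,k-2\}$ order-preserving. A path from $\sigma$ to $\emptyset$ is a finite sequence of vertices starting at $\sigma$, ending at $\emptyset$, each consecutive pair joined by an arrow; $\ell_0(p),\ell_1(p),\ell_2(p)$ are the numbers of solid, dashed, squiggled arrows used, and $\ell(p)=\ell_0(p)+\ell_1(p)+\ell_2(p)$. *)

theory Defs
  imports "HOL-Probability.Probability"
begin

section \<open>The symmetric space and its invariant measure\<close>

text \<open>A complex \<open>d \<times> d\<close> matrix is an element of \<^typ>\<open>complex ^ 'n ^ 'n\<close>. The rows and columns are
  numbered \<open>1, \<dots>, d\<close> by a bijection \<open>e\<close> from \<open>{1..d}\<close> onto the index type \<^typ>\<open>'n\<close>, so that the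
  \<open>(i, j)\<close> entry of \<open>s\<close> is \<open>s $ e i $ e j\<close>.\<close>

definition conj_transpose :: "complex ^ 'n ^ 'n \<Rightarrow> complex ^ 'n ^ 'n" where
  "conj_transpose A = (\<chi> i j. cnj (A $ j $ i))"

definition unitary_group :: "(complex ^ 'n ^ 'n) set" where
  "unitary_group = {g. g ** conj_transpose g = mat 1 \<and> conj_transpose g ** g = mat 1}"

text \<open>The Haar probability measure: the left-invariant Borel probability measure on the compact
  group \<open>U(d)\<close>. Regularity is automatic since \<open>U(d)\<close> is a compact metric space.\<close>

definition is_haar_unitary :: "(complex ^ 'n ^ 'n) measure \<Rightarrow> bool" where
  "is_haar_unitary \<mu> \<longleftrightarrow>
     prob_space \<mu> \<and>
     sets \<mu> = sets (restrict_space borel unitary_group) \<and>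
     (\<forall>g \<in> unitary_group. distr \<mu> \<mu> (\<lambda>h. g ** h) = \<mu>)"

text \<open>\<open>I'\<^sub>a\<^sub>b\<close>: the first \<open>a\<close> diagonal entries are \<open>1\<close>, the remaining ones \<open>-1\<close>.\<close>

definition signature_mat :: "(nat \<Rightarrow> 'n) \<Rightarrow> nat \<Rightarrow> complex ^ 'n ^ 'n" where
  "signature_mat e a = (\<chi> i j. if i = j then (if i \<in> e ` {1..a} then 1 else -1) else 0)"

definition AIII_map :: "(nat \<Rightarrow> 'n) \<Rightarrow> nat \<Rightarrow> complex ^ 'n ^ 'n \<Rightarrow> complex ^ 'n ^ 'n" where
  "AIII_map e a g = g ** signature_mat e a ** conj_transpose g"

definition AIII_space :: "(nat \<Rightarrow> 'n) \<Rightarrow> nat \<Rightarrow> (complex ^ 'n ^ 'n) set" where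
  "AIII_space e a = AIII_map e a ` unitary_group"

definition AIII_measure ::
  "(complex ^ 'n ^ 'n) measure \<Rightarrow> (nat \<Rightarrow> 'n) \<Rightarrow> nat \<Rightarrow> (complex ^ 'n ^ 'n) measure" where
  "AIII_measure \<mu> e a = distr \<mu> (restrict_space borel (AIII_space e a)) (AIII_map e a)"

text \<open>Here \<open>\<mu>\<close> is the Haar measure of \<open>U(d)\<close>; \<open>b\<close> enters through \<open>d = a + b\<close> only.\<close>

definition Wg_AIII ::
  "(complex ^ 'n ^ 'n) measure \<Rightarrow> (nat \<Rightarrow> 'n) \<Rightarrow> nat \<Rightarrow> nat \<Rightarrow> (nat \<Rightarrow> nat) \<Rightarrow> complex" where
  "Wg_AIII \<mu> e a k \<sigma> = (LINT s | AIII_measure \<mu> e a. (\<Prod>i = 1..k. s $ e i $ e (\<sigma> i)))"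


section \<open>The Weingarten graph\<close>

text \<open>An element of \<open>S\<^sub>k\<close> is a function \<open>\<sigma>\<close> with \<open>\<sigma> permutes {1..k}\<close>, hence the identity outside
  \<open>{1..k}\<close>. One such function belongs to many \<open>S\<^sub>k\<close>, so a vertex carries \<open>k\<close>; the vertex
  \<open>\<emptyset> \<in> S\<^sub>0\<close> is \<open>(0, id)\<close>.\<close>

type_synonym vertex = "nat \<times> (nat \<Rightarrow> nat)"

definition vertices :: "vertex set" where
  "vertices = {(k, \<sigma>). \<sigma> permutes {1..k}}"

definition empty_vertex :: vertex where
  "empty_vertex = (0, id)"

fun solid_arrow :: "vertex \<Rightarrow> vertex \<Rightarrow> bool" where
  "solid_arrow (k, \<sigma>) w \<longleftrightarrow>
     k \<ge> 2 \<and> (\<exists>i \<in> {1..<k}. w = (k, Transposition.transpose i k \<circ> \<sigma>))"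

definition perm_down :: "nat \<Rightarrow> (nat \<Rightarrow> nat) \<Rightarrow> (nat \<Rightarrow> nat)" where
  "perm_down k \<sigma> = (\<lambda>x. if x \<in> {1..k - 1} then \<sigma> x else x)"

fun dashed_arrow :: "vertex \<Rightarrow> vertex \<Rightarrow> bool" where
  "dashed_arrow (k, \<sigma>) w \<longleftrightarrow> k \<ge> 1 \<and> \<sigma> k = k \<and> w = (k - 1, perm_down k \<sigma>)"

text \<open>The order-preserving relabelling of \<open>{1..k - 1} - {r}\<close> by \<open>{1..k - 2}\<close>.\<close>

definition relabel :: "nat \<Rightarrow> nat \<Rightarrow> nat" where
  "relabel r x = (if x < r then x else x - 1)"

definition perm_flat :: "nat \<Rightarrow> (nat \<Rightarrow> nat) \<Rightarrow> (nat \<Rightarrow> nat)" where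
  "perm_flat k \<sigma> = (let r = \<sigma> k; T = {1..k - 1} - {r} in
     (\<lambda>y. if y \<in> {1..k - 2} then relabel r (\<sigma> (inv_into T (relabel r) y)) else y))"

fun squiggled_arrow :: "vertex \<Rightarrow> vertex \<Rightarrow> bool" where
  "squiggled_arrow (k, \<sigma>) w \<longleftrightarrow>
     k \<ge> 2 \<and> \<sigma> k \<noteq> k \<and> \<sigma> (\<sigma> k) = k \<and> w = (k - 2, perm_flat k \<sigma>)"

definition arrow :: "vertex \<Rightarrow> vertex \<Rightarrow> bool" where
  "arrow v w \<longleftrightarrow> solid_arrow v w \<or> dashed_arrow v w \<or> squiggled_arrow v w"

definition paths_from :: "vertex \<Rightarrow> vertex list set" where
  "paths_from v = {p. p \<noteq> [] \<and> set p \<subseteq> vertices \<and> hd p = v \<and> last p = empty_vertex \<and>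
     successively arrow p}"

text \<open>The three kinds of arrows lower \<open>k\<close> by \<open>0\<close>, \<open>1\<close> and \<open>2\<close>, and two different solid arrows from
  one vertex have different targets. So two consecutive vertices determine the arrow between them,
  and a path is determined by its vertices.\<close>

definition count_steps :: "(vertex \<Rightarrow> vertex \<Rightarrow> bool) \<Rightarrow> vertex list \<Rightarrow> nat" where
  "count_steps R p = card {i. Suc i < length p \<and> R (p ! i) (p ! Suc i)}"

definition solid_length :: "vertex list \<Rightarrow> nat" where
  "solid_length = count_steps solid_arrow"

definition dashed_length :: "vertex list \<Rightarrow> nat" where
  "dashed_length = count_steps dashed_arrow"

definition squiggled_length :: "vertex list \<Rightarrow> nat" where
  "squiggled_length = count_steps squiggled_arrow"

definition path_length :: "vertex list \<Rightarrow> nat" where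
  "path_length p = solid_length p + dashed_length p + squiggled_length p"

lemma strict_mono_on_relabel: "strict_mono_on ({1..k - 1} - {r}) (relabel r)"
  by (auto simp: strict_mono_on_def relabel_def)

lemma bij_betw_relabel:
  assumes "r \<in> {1..<k}"
  shows "bij_betw (relabel r) ({1..k - 1} - {r}) {1..k - 2}"
proof (rule bij_betw_imageI)
  show "inj_on (relabel r) ({1..k - 1} - {r})"
    by (rule strict_mono_on_imp_inj_on[OF strict_mono_on_relabel])
  show "relabel r ` ({1..k - 1} - {r}) = {1..k - 2}"
  proof (intro equalityI subsetI)
    fix y assume y: "y \<in> {1..k - 2}"
    have "relabel r (if y < r then y else Suc y) = y"
      by (simp add: relabel_def)
    moreover have "(if y < r then y else Suc y) \<in> {1..k - 1} - {r}"
      using y assms by auto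
    ultimately show "y \<in> relabel r ` ({1..k - 1} - {r})"
      by (rule image_eqI[OF sym])
  qed (use assms in \<open>auto simp: relabel_def\<close>)
qed

lemma perm_flat_permutes:
  assumes "\<sigma> permutes {1..k}" "\<sigma> k \<noteq> k" "\<sigma> (\<sigma> k) = k" "k \<ge> 2"
  shows "perm_flat k \<sigma> permutes {1..k - 2}"
proof -
  define r T where "r = \<sigma> k" and "T = {1..k - 1} - {r}"
  have "\<sigma> k \<in> {1..k}" using assms by (simp only: permutes_in_image) simp
  hence r: "r \<in> {1..<k}" using assms(2) by (auto simp: r_def)
  have T: "T = {1..k} - {k, r}" using r by (auto simp: T_def)
  have "\<sigma> ` T = \<sigma> ` {1..k} - \<sigma> ` {k, r}"
    unfolding T by (rule image_set_diff[OF permutes_inj[OF assms(1)]])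
  also have "\<dots> = T"
    unfolding permutes_image[OF assms(1)] T using assms(3) by (auto simp: r_def)
  finally have b: "bij_betw \<sigma> T T"
    by (intro bij_betw_imageI permutes_inj_on[OF assms(1)])
  have i: "bij_betw (relabel r) T {1..k - 2}" using bij_betw_relabel[OF r] by (simp add: T_def)
  have "bij_betw (relabel r \<circ> (\<sigma> \<circ> inv_into T (relabel r))) {1..k - 2} {1..k - 2}"
    by (rule bij_betw_trans[OF bij_betw_trans[OF bij_betw_inv_into[OF i] b] i])
  hence "bij_betw (perm_flat k \<sigma>) {1..k - 2} {1..k - 2}"
    by (rule iffD1[OF bij_betw_cong, rotated]) (simp add: perm_flat_def Let_def r_def T_def)
  thus ?thesis
    by (rule bij_imp_permutes) (auto simp: perm_flat_def Let_def)
qed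

end

theory Submission
  imports Defs
begin

text \<open>For a random \<open>s = g I'\<^sub>a\<^sub>b g\<^sup>*\<close>, replace the row index \<open>k\<close> and the column index \<open>k\<close> of the moment
  defining \<open>Wg(\<sigma>)\<close> by \<open>j\<close>, and sum over \<open>j = 1, \<dots>, d\<close>. Pointwise the sum is evaluated by
  \<open>tr s = d\<^sup>-\<close> if \<open>\<sigma>\<close> fixes \<open>k\<close>, and by \<open>s\<^sup>2 = 1\<close> otherwise. On the other hand, unitary invariance
  shows that the \<open>j\<close>-th term is \<open>Wg(\<sigma>)\<close> for \<open>j \<ge> k\<close> and \<open>Wg(\<sigma>) + Wg((j, k) \<sigma>)\<close> for \<open>j < k\<close>. This gives a
  linear recurrence for \<open>d Wg(\<sigma>)\<close> along the arrows of the Weingarten graph. The sum over paths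
  converges absolutely and satisfies the same recurrence, whose solution is unique since
  \<open>(k - 1) / d < 1\<close>.\<close>

section \<open>Sums over paths\<close>

definition nbrs :: "vertex \<Rightarrow> vertex set" where
  "nbrs v = {w \<in> vertices. arrow v w}"

text \<open>The order of the tests is immaterial: the three kinds of arrows lower the level by 0, 1
  and 2, so at most one test succeeds. The type is general because the weights also occur over the
  reals, with norms in place of \<open>c0\<close>, \<open>c1\<close>, \<open>c2\<close>.\<close>

definition step_weight :: "'a::zero \<Rightarrow> 'a \<Rightarrow> 'a \<Rightarrow> vertex \<Rightarrow> vertex \<Rightarrow> 'a" where
  "step_weight c0 c1 c2 v w =
     (if solid_arrow v w then c0 else if dashed_arrow v w then c1
      else if squiggled_arrow v w then c2 else 0)"

text \<open>Three independent weights keep the convergence argument apart from the values -1/d, (a -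
  b)/d and 1/d that are inserted at the end.\<close>

definition path_weight :: "'a::comm_monoid_mult \<Rightarrow> 'a \<Rightarrow> 'a \<Rightarrow> vertex list \<Rightarrow> 'a" where
  "path_weight c0 c1 c2 p = c0 ^ solid_length p * c1 ^ dashed_length p * c2 ^ squiggled_length p"

lemma solid_arrow_fst: "solid_arrow v w \<Longrightarrow> fst w = fst v"
  by (cases v) auto

lemma dashed_arrow_fst: "dashed_arrow v w \<Longrightarrow> fst v = Suc (fst w)"
  by (cases v) auto

lemma squiggled_arrow_fst: "squiggled_arrow v w \<Longrightarrow> fst v = Suc (Suc (fst w))"
  by (cases v) auto

lemma count_steps_Cons:
  assumes "p \<noteq> []"
  shows "count_steps R (v # p) = (if R v (hd p) then 1 else 0) + count_steps R p"
proof -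
  let ?A = "{i. Suc i < length p \<and> R (p ! i) (p ! Suc i)}"
  have "{i. Suc i < length (v # p) \<and> R ((v # p) ! i) ((v # p) ! Suc i)}
      = (if R v (hd p) then {0} else {}) \<union> Suc ` ?A" (is "?L = ?R")
  proof (rule set_eqI)
    fix i show "i \<in> ?L \<longleftrightarrow> i \<in> ?R"
      using assms by (cases i) (auto simp: hd_conv_nth)
  qed
  moreover have "finite ?A" by (rule finite_subset[of _ "{..<length p}"]) auto
  ultimately show ?thesis
    by (auto simp: count_steps_def card_image)
qed

text \<open>The levels of \<open>v\<close> and \<open>hd p\<close> determine the kind of the arrow,
  so exactly one of the three counts grows, and it grows by one.\<close>

lemma path_weight_Cons:
  fixes c0 c1 c2 :: "'a::comm_semiring_1"
  assumes "p \<noteq> []" "arrow v (hd p)"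
  shows "path_weight c0 c1 c2 (v # p) = step_weight c0 c1 c2 v (hd p) * path_weight c0 c1 c2 p"
  using assms solid_arrow_fst[of v "hd p"] dashed_arrow_fst[of v "hd p"]
    squiggled_arrow_fst[of v "hd p"]
  by (auto simp: path_weight_def step_weight_def arrow_def count_steps_Cons
        solid_length_def dashed_length_def squiggled_length_def mult_ac)

lemma count_steps_single [simp]: "count_steps R [v] = 0"
  by (simp add: count_steps_def)

lemma not_arrow_empty: "\<not> arrow empty_vertex w"
  by (auto simp: arrow_def empty_vertex_def)

lemma paths_from_empty: "paths_from empty_vertex = {[empty_vertex]}"
proof (intro equalityI subsetI)
  fix p assume p: "p \<in> paths_from empty_vertex"
  then obtain q where q: "p = empty_vertex # q"
    by (cases p) (auto simp: paths_from_def)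
  show "p \<in> {[empty_vertex]}"
    using p q by (cases q) (auto simp: paths_from_def not_arrow_empty)
qed (auto simp: paths_from_def vertices_def empty_vertex_def)

text \<open>Splitting off the first arrow is the source of every recurrence for path sums. Excluding
  the empty vertex rules out the one-vertex path.\<close>

lemma paths_from_Cons:
  assumes "v \<in> vertices" "v \<noteq> empty_vertex"
  shows "paths_from v = (\<Union>w\<in>nbrs v. (#) v ` paths_from w)"
proof (intro equalityI subsetI)
  fix p assume p: "p \<in> paths_from v"
  then obtain q where q: "p = v # q"
    by (cases p) (auto simp: paths_from_def)
  obtain w r where "q = w # r"
    using p q assms by (cases q) (auto simp: paths_from_def)
  with p q have "w \<in> nbrs v" "q \<in> paths_from w"
    by (auto simp: paths_from_def nbrs_def)
  with q show "p \<in> (\<Union>w\<in>nbrs v. (#) v ` paths_from w)" by blast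
next
  fix p assume "p \<in> (\<Union>w\<in>nbrs v. (#) v ` paths_from w)"
  then obtain w q where "w \<in> nbrs v" "q \<in> paths_from w" "p = v # q" by auto
  thus "p \<in> paths_from v"
    using assms by (cases q) (auto simp: paths_from_def nbrs_def)
qed

section \<open>Explicit description of the neighbours of a vertex\<close>

lemma solid_vertex:
  fixes i k :: nat
  assumes "\<sigma> permutes {1..k}" "i \<in> {1..<k}"
  shows "Transposition.transpose i k \<circ> \<sigma> permutes {1..k}"
  using assms by (intro permutes_compose permutes_swap_id) auto

text \<open>A permutation of \<open>{1..k}\<close> is the identity outside that set, so a dashed
  arrow keeps the function and changes only the level.\<close>

lemma perm_down_permutes:
  assumes "\<sigma> permutes {1..k}" "\<sigma> k = k"
  shows "perm_down k \<sigma> = \<sigma>" "\<sigma> permutes {1..k - 1}"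
proof -
  show p: "\<sigma> permutes {1..k - 1}"
  proof (rule permutes_superset[OF assms(1)])
    fix x assume "x \<in> {1..k} - {1..k - 1}"
    hence "x = k" by auto
    thus "\<sigma> x = x" using assms(2) by simp
  qed
  show "perm_down k \<sigma> = \<sigma>"
    using permutes_not_in[OF p] by (auto simp: perm_down_def)
qed

lemma ge_2_of_moved:
  fixes k :: nat
  assumes "\<sigma> permutes {1..k}" "\<sigma> k \<noteq> k"
  shows "k \<ge> 2"
proof -
  have "k \<in> {1..k}" using assms permutes_not_in by metis
  moreover from this have "\<sigma> k \<in> {1..k}" by (simp only: permutes_in_image[OF assms(1)])
  ultimately show ?thesis using assms(2) by auto
qed

text \<open>Each kind of arrow contributes its own term; this brings abstract sums over neighbours
  into the explicit form in which the recurrence for moments is derived.\<close>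

lemma nbrs_sum:
  fixes c0 c1 c2 :: "'a::comm_ring_1" and X :: "vertex \<Rightarrow> 'a"
  assumes \<sigma>: "\<sigma> permutes {1..k}" and k: "k \<ge> 1"
  shows "finite (nbrs (k, \<sigma>))"
    and "(\<Sum>w\<in>nbrs (k, \<sigma>). step_weight c0 c1 c2 (k, \<sigma>) w * X w) =
      c0 * (\<Sum>i\<in>{1..<k}. X (k, Transposition.transpose i k \<circ> \<sigma>)) +
      (if \<sigma> k = k then c1 * X (k - 1, \<sigma>)
       else if \<sigma> (\<sigma> k) = k then c2 * X (k - 2, perm_flat k \<sigma>) else 0)"
proof -
  define f where "f = (\<lambda>i. (k, Transposition.transpose i k \<circ> \<sigma>))"
  define S where "S = f ` {1..<k}"
  define L where "L = (if \<sigma> k = k then {(k - 1, \<sigma>)}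
       else if \<sigma> (\<sigma> k) = k then {(k - 2, perm_flat k \<sigma>)} else {})"
  have k2: "k \<ge> 2" if "\<sigma> k \<noteq> k" using \<sigma> that by (rule ge_2_of_moved)
  \<comment> \<open>Solid arrows require \<open>k \<ge> 2\<close>; at \<open>k = 1\<close> the range
    \<open>{1..<k}\<close> is empty, so the description by \<open>S\<close> is right there as
    well.\<close>
  have solid: "solid_arrow (k, \<sigma>) w \<longleftrightarrow> w \<in> S" for w
    by (cases "k = 1") (use k in \<open>auto simp: S_def f_def\<close>)
  have N: "nbrs (k, \<sigma>) = S \<union> L"
    using k k2 perm_down_permutes[OF \<sigma>] perm_flat_permutes[OF \<sigma>] solid_vertex[OF \<sigma>]
    unfolding nbrs_def arrow_def solid
    by (auto simp: S_def f_def L_def vertices_def)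
  show "finite (nbrs (k, \<sigma>))" unfolding N by (simp add: S_def L_def)
  have inj: "inj_on f {1..<k}"
  proof (rule inj_onI)
    fix i j assume ij: "i \<in> {1..<k}" "j \<in> {1..<k}" "f i = f j"
    \<comment> \<open>At \<open>inv \<sigma> k\<close> the two compositions take the values
      \<open>i\<close> and \<open>j\<close>.\<close>
    have "(Transposition.transpose i k \<circ> \<sigma>) (inv \<sigma> k) = (Transposition.transpose j k \<circ> \<sigma>) (inv \<sigma> k)"
      using ij(3) unfolding f_def by (simp only: prod.inject)
    thus "i = j" using permutes_inverses(1)[OF \<sigma>] by simp
  qed
  have disj: "S \<inter> L = {}" using k by (auto simp: S_def f_def L_def)
  have 1: "(\<Sum>w\<in>S. step_weight c0 c1 c2 (k, \<sigma>) w * X w) = c0 * (\<Sum>i\<in>{1..<k}. X (f i))"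
  proof -
    have "(\<Sum>w\<in>S. step_weight c0 c1 c2 (k, \<sigma>) w * X w) = (\<Sum>w\<in>S. c0 * X w)"
      by (intro sum.cong refl) (simp add: step_weight_def solid del: solid_arrow.simps)
    also have "\<dots> = c0 * (\<Sum>i\<in>{1..<k}. X (f i))"
      unfolding S_def by (subst sum.reindex[OF inj]) (simp add: sum_distrib_left)
    finally show ?thesis .
  qed
  have ns: "w \<in> L \<Longrightarrow> \<not> solid_arrow (k, \<sigma>) w" for w
    using disj solid by blast
  have 2: "(\<Sum>w\<in>L. step_weight c0 c1 c2 (k, \<sigma>) w * X w) =
      (if \<sigma> k = k then c1 * X (k - 1, \<sigma>)
       else if \<sigma> (\<sigma> k) = k then c2 * X (k - 2, perm_flat k \<sigma>) else 0)"
    using ns k k2 perm_down_permutes[OF \<sigma>]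
    by (auto simp: L_def step_weight_def simp del: solid_arrow.simps)
  show "(\<Sum>w\<in>nbrs (k, \<sigma>). step_weight c0 c1 c2 (k, \<sigma>) w * X w) =
      c0 * (\<Sum>i\<in>{1..<k}. X (k, Transposition.transpose i k \<circ> \<sigma>)) +
      (if \<sigma> k = k then c1 * X (k - 1, \<sigma>)
       else if \<sigma> (\<sigma> k) = k then c2 * X (k - 2, perm_flat k \<sigma>) else 0)"
    unfolding N by (subst sum.union_disjoint) (simp_all add: 1 2 disj, simp_all add: S_def L_def f_def)
qed

lemma finite_nbrs:
  assumes "v \<in> vertices"
  shows "finite (nbrs v)"
proof (cases "v = empty_vertex")
  case True
  thus ?thesis by (simp add: nbrs_def not_arrow_empty)
next
  case False
  obtain k \<sigma> where v: "v = (k, \<sigma>)" by (cases v)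
  have "k \<ge> 1"
    using False assms v by (cases k) (auto simp: vertices_def empty_vertex_def)
  thus ?thesis using nbrs_sum(1)[of \<sigma> k] assms v by (auto simp: vertices_def)
qed

section \<open>Absolute convergence by truncation\<close>

lemma norm_step_weight:
  "norm (step_weight c0 c1 c2 v w) = step_weight (norm c0) (norm c1) (norm c2) v w"
  by (simp add: step_weight_def)

text \<open>Solid arrows can be retraced, so the set of all paths may be infinite; the truncation is
  finite. \<open>length\<close> counts vertices, so \<open>n\<close> vertices mean
  \<open>n - 1\<close> arrows.\<close>

definition paths_upto :: "nat \<Rightarrow> vertex \<Rightarrow> vertex list set" where
  "paths_upto n v = {p \<in> paths_from v. length p \<le> n}"

lemma paths_upto_0: "paths_upto 0 v = {}"
  by (auto simp: paths_upto_def paths_from_def)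

lemma paths_upto_Suc:
  assumes "v \<in> vertices" "v \<noteq> empty_vertex"
  shows "paths_upto (Suc n) v = (\<Union>w\<in>nbrs v. (#) v ` paths_upto n w)"
  unfolding paths_upto_def paths_from_Cons[OF assms] by auto

lemma finite_paths_upto: "v \<in> vertices \<Longrightarrow> finite (paths_upto n v)"
proof (induction n arbitrary: v)
  case (Suc n)
  show ?case
  proof (cases "v = empty_vertex")
    case False
    have "nbrs v \<subseteq> vertices" by (auto simp: nbrs_def)
    thus ?thesis unfolding paths_upto_Suc[OF Suc.prems False]
      using Suc finite_nbrs by auto
  qed (auto simp: paths_upto_def paths_from_empty)
qed (simp add: paths_upto_0)

lemma path_weight_nbr:
  fixes c0 c1 c2 :: "'a::comm_semiring_1"
  assumes "w \<in> nbrs v" "p \<in> paths_from w"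
  shows "path_weight c0 c1 c2 (v # p) = step_weight c0 c1 c2 v w * path_weight c0 c1 c2 p"
  using path_weight_Cons[of p v] assms by (auto simp: nbrs_def paths_from_def)

lemma paths_from_disjoint: "w \<noteq> w' \<Longrightarrow> paths_from w \<inter> paths_from w' = {}"
  by (auto simp: paths_from_def)

text \<open>The bound reproduces itself: the \<open>k - 1\<close> solid arrows contribute at most
  \<open>(k - 1) * d ^ (k - 1)\<close>, and at most one further arrow contributes at most
  \<open>d ^ (k - 1)\<close>. The total \<open>k * d ^ (k - 1)\<close> is at most
  \<open>d ^ k\<close> because \<open>k \<le> d\<close>. The bound is uniform in \<open>n\<close>,
  which is what summability requires.\<close>

lemma sum_paths_upto_le:
  fixes c0 c1 c2 :: complex and d :: nat
  assumes c: "norm c0 \<le> 1 / d" "norm c1 \<le> 1" "norm c2 \<le> 1" and d: "d \<ge> 1"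
  shows "\<sigma> permutes {1..k} \<Longrightarrow> k \<le> d \<Longrightarrow>
    (\<Sum>p\<in>paths_upto n (k, \<sigma>). norm (path_weight c0 c1 c2 p)) \<le> real d ^ k"
proof (induction n arbitrary: k \<sigma>)
  case 0
  thus ?case by (simp add: paths_upto_0)
next
  case (Suc n)
  define S where "S = (\<lambda>w. \<Sum>p\<in>paths_upto n w. norm (path_weight c0 c1 c2 p))"
  have S0: "S w \<ge> 0" for w by (simp add: S_def sum_nonneg)
  have v: "(k, \<sigma>) \<in> vertices" using Suc.prems by (simp add: vertices_def)
  show ?case
  proof (cases "k = 0")
    case True
    hence "(k, \<sigma>) = empty_vertex" using Suc.prems by (simp add: empty_vertex_def)
    hence "paths_upto (Suc n) (k, \<sigma>) = {[empty_vertex]}"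
      by (auto simp: paths_upto_def paths_from_empty)
    thus ?thesis using True
      by (simp add: path_weight_def solid_length_def dashed_length_def squiggled_length_def)
  next
    case False
    hence ne: "(k, \<sigma>) \<noteq> empty_vertex" by (simp add: empty_vertex_def)
    have k: "k \<ge> 1" using False by simp
    have nv: "w \<in> nbrs (k, \<sigma>) \<Longrightarrow> w \<in> vertices" for w by (simp add: nbrs_def)
    have "(\<Sum>p\<in>paths_upto (Suc n) (k, \<sigma>). norm (path_weight c0 c1 c2 p))
        = (\<Sum>w\<in>nbrs (k, \<sigma>). \<Sum>p\<in>(#) (k, \<sigma>) ` paths_upto n w. norm (path_weight c0 c1 c2 p))"
      unfolding paths_upto_Suc[OF v ne]
    proof (rule sum.UNION_disjoint)
      show "\<forall>i\<in>nbrs (k, \<sigma>). \<forall>j\<in>nbrs (k, \<sigma>). i \<noteq> j \<longrightarrow>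
        (#) (k, \<sigma>) ` paths_upto n i \<inter> (#) (k, \<sigma>) ` paths_upto n j = {}"
        using paths_from_disjoint unfolding paths_upto_def by blast
    qed (use finite_nbrs[OF v] finite_paths_upto nv in auto)
    also have "\<dots> = (\<Sum>w\<in>nbrs (k, \<sigma>).
        step_weight (norm c0) (norm c1) (norm c2) (k, \<sigma>) w * S w)"
    proof (rule sum.cong[OF refl])
      fix w assume w: "w \<in> nbrs (k, \<sigma>)"
      have "(\<Sum>p\<in>(#) (k, \<sigma>) ` paths_upto n w. norm (path_weight c0 c1 c2 p))
          = (\<Sum>p\<in>paths_upto n w. norm (path_weight c0 c1 c2 ((k, \<sigma>) # p)))"
        by (subst sum.reindex) (simp_all only: inj_on_def list.inject o_def, blast)
      also have "\<dots> = (\<Sum>p\<in>paths_upto n w.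
          norm (step_weight c0 c1 c2 (k, \<sigma>) w) * norm (path_weight c0 c1 c2 p))"
        by (rule sum.cong[OF refl])
           (simp only: paths_upto_def mem_Collect_eq path_weight_nbr[OF w] norm_mult)
      finally show "(\<Sum>p\<in>(#) (k, \<sigma>) ` paths_upto n w. norm (path_weight c0 c1 c2 p))
          = step_weight (norm c0) (norm c1) (norm c2) (k, \<sigma>) w * S w"
        by (simp only: S_def sum_distrib_left norm_step_weight)
    qed
    also have "\<dots> = norm c0 * (\<Sum>i\<in>{1..<k}. S (k, Transposition.transpose i k \<circ> \<sigma>)) +
      (if \<sigma> k = k then norm c1 * S (k - 1, \<sigma>)
       else if \<sigma> (\<sigma> k) = k then norm c2 * S (k - 2, perm_flat k \<sigma>) else 0)"
      by (rule nbrs_sum(2)[OF Suc.prems(1) k])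
    also have "\<dots> \<le> (1 / d) * ((k - 1) * real d ^ k) + real d ^ (k - 1)"
    proof (rule add_mono)
      have "(\<Sum>i\<in>{1..<k}. S (k, Transposition.transpose i k \<circ> \<sigma>)) \<le> (\<Sum>i\<in>{1..<k}. real d ^ k)"
        unfolding S_def using Suc.prems by (intro sum_mono Suc.IH solid_vertex)
      hence "(\<Sum>i\<in>{1..<k}. S (k, Transposition.transpose i k \<circ> \<sigma>)) \<le> (k - 1) * real d ^ k"
        by simp
      thus "norm c0 * (\<Sum>i\<in>{1..<k}. S (k, Transposition.transpose i k \<circ> \<sigma>))
          \<le> (1 / d) * ((k - 1) * real d ^ k)"
        by (intro mult_mono c) (auto intro: sum_nonneg S0)
      have "norm c1 * S (k - 1, \<sigma>) \<le> 1 * real d ^ (k - 1)" if "\<sigma> k = k"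
        using Suc.prems that perm_down_permutes(2)[OF Suc.prems(1) that]
        by (intro mult_mono c S0) (auto simp: S_def intro!: Suc.IH)
      moreover have "norm c2 * S (k - 2, perm_flat k \<sigma>) \<le> 1 * real d ^ (k - 1)"
        if *: "\<sigma> k \<noteq> k" "\<sigma> (\<sigma> k) = k"
      proof (intro mult_mono c S0)
        have "k \<ge> 2" using Suc.prems(1) *(1) by (rule ge_2_of_moved)
        hence "S (k - 2, perm_flat k \<sigma>) \<le> real d ^ (k - 2)"
          unfolding S_def using Suc.prems * by (intro Suc.IH perm_flat_permutes) auto
        also have "\<dots> \<le> real d ^ (k - 1)" using d by (intro power_increasing) auto
        finally show "S (k - 2, perm_flat k \<sigma>) \<le> real d ^ (k - 1)" .
      qed auto
      ultimately show "(if \<sigma> k = k then norm c1 * S (k - 1, \<sigma>)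
       else if \<sigma> (\<sigma> k) = k then norm c2 * S (k - 2, perm_flat k \<sigma>) else 0) \<le> real d ^ (k - 1)"
        by simp
    qed
    also have "\<dots> \<le> real d ^ k"
    proof -
      obtain m where m: "k = Suc m" using k by (cases k) auto
      have "(1 / d) * ((k - 1) * real d ^ k) + real d ^ (k - 1) = real k * real d ^ m"
        using d by (simp add: m field_simps)
      also have "\<dots> \<le> real d * real d ^ m"
        using Suc.prems by (intro mult_right_mono) auto
      finally show ?thesis by (simp add: m)
    qed
    finally show ?thesis .
  qed
qed

text \<open>Every finite set of paths lies in some truncation, so the uniform bound controls all
  finite partial sums of norms.\<close>

lemma path_weight_summable:
  fixes c0 c1 c2 :: complex and d :: nat
  assumes c: "norm c0 \<le> 1 / d" "norm c1 \<le> 1" "norm c2 \<le> 1" and d: "d \<ge> 1"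
    and \<sigma>: "\<sigma> permutes {1..k}" and k: "k \<le> d"
  shows "path_weight c0 c1 c2 summable_on paths_from (k, \<sigma>)"
proof (rule abs_summable_summable, rule nonneg_bdd_above_summable_on)
  show "bdd_above (sum (\<lambda>p. norm (path_weight c0 c1 c2 p)) ` {F. F \<subseteq> paths_from (k, \<sigma>) \<and> finite F})"
  proof (rule bdd_aboveI2)
    fix F assume F: "F \<in> {F. F \<subseteq> paths_from (k, \<sigma>) \<and> finite F}"
    define n where "n = Max (length ` F)"
    have sub: "F \<subseteq> paths_upto n (k, \<sigma>)"
      using F by (auto simp: paths_upto_def n_def)
    have "sum (\<lambda>p. norm (path_weight c0 c1 c2 p)) F
        \<le> sum (\<lambda>p. norm (path_weight c0 c1 c2 p)) (paths_upto n (k, \<sigma>))"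
      using \<sigma> by (intro sum_mono2 sub finite_paths_upto) (auto simp: vertices_def)
    also have "\<dots> \<le> real d ^ k" by (rule sum_paths_upto_le[OF c d \<sigma> k])
    finally show "sum (\<lambda>p. norm (path_weight c0 c1 c2 p)) F \<le> real d ^ k" .
  qed
qed simp

section \<open>Recurrence for path sums and uniqueness of its solution\<close>

lemma nbrs_fst: "w \<in> nbrs v \<Longrightarrow> fst w \<le> fst v"
  by (auto simp: nbrs_def arrow_def dest!: solid_arrow_fst dashed_arrow_fst squiggled_arrow_fst)

text \<open>The decomposition by the first arrow is finite and disjoint. Levels never rise along
  arrows, so each piece starts at a level at most \<open>d\<close> and is summable.\<close>

lemma infsum_paths_rec:
  fixes c0 c1 c2 :: complex and d :: nat
  assumes c: "norm c0 \<le> 1 / d" "norm c1 \<le> 1" "norm c2 \<le> 1" and d: "d \<ge> 1"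
    and \<sigma>: "\<sigma> permutes {1..k}" and k: "k \<le> d" "k \<ge> 1"
  shows "infsum (path_weight c0 c1 c2) (paths_from (k, \<sigma>)) =
    (\<Sum>w\<in>nbrs (k, \<sigma>). step_weight c0 c1 c2 (k, \<sigma>) w * infsum (path_weight c0 c1 c2) (paths_from w))"
proof -
  have v: "(k, \<sigma>) \<in> vertices" using \<sigma> by (simp add: vertices_def)
  have ne: "(k, \<sigma>) \<noteq> empty_vertex" using k by (simp add: empty_vertex_def)
  have "(path_weight c0 c1 c2 has_sum
    (\<Sum>w\<in>nbrs (k, \<sigma>). step_weight c0 c1 c2 (k, \<sigma>) w * infsum (path_weight c0 c1 c2) (paths_from w)))
      (\<Union>w\<in>nbrs (k, \<sigma>). (#) (k, \<sigma>) ` paths_from w)"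
  proof (rule sum_has_sum)
    show "finite (nbrs (k, \<sigma>))" by (rule finite_nbrs[OF v])
    fix w assume w: "w \<in> nbrs (k, \<sigma>)"
    hence "snd w permutes {1..fst w}" "fst w \<le> d"
      using nbrs_fst[OF w] k by (auto simp: nbrs_def vertices_def)
    from path_weight_summable[OF c d this]
    have "(path_weight c0 c1 c2 has_sum infsum (path_weight c0 c1 c2) (paths_from w)) (paths_from w)"
      by simp
    hence "((\<lambda>p. step_weight c0 c1 c2 (k, \<sigma>) w * path_weight c0 c1 c2 p) has_sum
      step_weight c0 c1 c2 (k, \<sigma>) w * infsum (path_weight c0 c1 c2) (paths_from w)) (paths_from w)"
      by (rule has_sum_cmult_right)
    moreover have "((path_weight c0 c1 c2 \<circ> (#) (k, \<sigma>)) has_sum x) (paths_from w) \<longleftrightarrow>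
      ((\<lambda>p. step_weight c0 c1 c2 (k, \<sigma>) w * path_weight c0 c1 c2 p) has_sum x) (paths_from w)" for x
      by (rule has_sum_cong) (simp add: path_weight_nbr[OF w])
    ultimately show "(path_weight c0 c1 c2 has_sum step_weight c0 c1 c2 (k, \<sigma>) w *
        infsum (path_weight c0 c1 c2) (paths_from w)) ((#) (k, \<sigma>) ` paths_from w)"
      by (subst has_sum_reindex) auto
  next
    fix w w' :: vertex assume "w \<noteq> w'"
    thus "(#) (k, \<sigma>) ` paths_from w \<inter> (#) (k, \<sigma>) ` paths_from w' = {}"
      using paths_from_disjoint[of w w'] by auto
  qed
  thus ?thesis unfolding paths_from_Cons[OF v ne] by (rule infsumI)
qed

text \<open>The recurrence determines its solution: the solid arrows contribute to level \<open>k\<close> an operator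
  of norm at most \<open>(k - 1) / d < 1\<close>.\<close>

lemma has_sum_paths:
  fixes c0 c1 c2 :: complex and d :: nat and X :: "vertex \<Rightarrow> complex"
  assumes c: "norm c0 \<le> 1 / d" "norm c1 \<le> 1" "norm c2 \<le> 1" and d: "d \<ge> 1"
    and X0: "X empty_vertex = 1"
    and X: "\<And>k \<sigma>. \<sigma> permutes {1..k} \<Longrightarrow> 1 \<le> k \<Longrightarrow> k \<le> d \<Longrightarrow>
      X (k, \<sigma>) = (\<Sum>w\<in>nbrs (k, \<sigma>). step_weight c0 c1 c2 (k, \<sigma>) w * X w)"
    and \<sigma>: "\<sigma> permutes {1..k}" and k: "k \<le> d"
  shows "(path_weight c0 c1 c2 has_sum X (k, \<sigma>)) (paths_from (k, \<sigma>))"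
proof -
  \<comment> \<open>The difference of two solutions satisfies the same linear recurrence and
    vanishes at the empty vertex.\<close>
  define Z where "Z = (\<lambda>w. X w - infsum (path_weight c0 c1 c2) (paths_from w))"
  have Z0: "Z empty_vertex = 0"
    by (simp add: Z_def X0 paths_from_empty path_weight_def solid_length_def dashed_length_def
        squiggled_length_def)
  have Z: "Z (k, \<sigma>) = (\<Sum>w\<in>nbrs (k, \<sigma>). step_weight c0 c1 c2 (k, \<sigma>) w * Z w)"
    if "\<sigma> permutes {1..k}" "1 \<le> k" "k \<le> d" for k \<sigma>
    using X[OF that] infsum_paths_rec[OF c d that(1,3,2)]
    by (simp add: Z_def right_diff_distrib sum_subtractf)
  have "Z (k, \<sigma>) = 0" if "\<sigma> permutes {1..k}" "k \<le> d" for k \<sigma>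
    using that
  proof (induction k arbitrary: \<sigma> rule: less_induct)
    case (less k)
    show ?case
    proof (cases "k = 0")
      case True
      hence "(k, \<sigma>) = empty_vertex" using less.prems by (simp add: empty_vertex_def)
      thus ?thesis using Z0 by simp
    next
      case False
      hence k: "k \<ge> 1" by simp
      \<comment> \<open>The maximum over the finite level \<open>k\<close> is attained at some
        \<tau>. There the lower-level terms vanish by induction, which leaves
        \<open>m \<le> ((k - 1) / d) * m\<close> and forces \<open>m \<le> 0\<close>.\<close>
      define m where "m = Max ((\<lambda>\<tau>. norm (Z (k, \<tau>))) ` {\<tau>. \<tau> permutes {1..k}})"
      have fin: "finite {\<tau>. \<tau> permutes {1..k}}" by (rule finite_permutations) simp
      have le: "norm (Z (k, \<tau>)) \<le> m" if "\<tau> permutes {1..k}" for \<tau>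
        unfolding m_def using fin that by (intro Max_ge) auto
      have "m \<in> (\<lambda>\<tau>. norm (Z (k, \<tau>))) ` {\<tau>. \<tau> permutes {1..k}}"
        unfolding m_def using fin less.prems by (intro Max_in) auto
      then obtain \<tau> where \<tau>: "\<tau> permutes {1..k}" "m = norm (Z (k, \<tau>))" by auto
      have down: "Z (k - 1, \<tau>) = 0" if "\<tau> k = k"
        using less k perm_down_permutes(2)[OF \<tau>(1) that] by auto
      have flat: "Z (k - 2, perm_flat k \<tau>) = 0" if "\<tau> k \<noteq> k" "\<tau> (\<tau> k) = k"
      proof -
        have "k \<ge> 2" using \<tau>(1) that(1) by (rule ge_2_of_moved)
        thus ?thesis using less perm_flat_permutes[OF \<tau>(1) that] by auto
      qed
      have "Z (k, \<tau>) = c0 * (\<Sum>i\<in>{1..<k}. Z (k, Transposition.transpose i k \<circ> \<tau>))"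
        unfolding Z[OF \<tau>(1) k less.prems(2)] nbrs_sum(2)[OF \<tau>(1) k]
        using down flat by simp
      hence "m = norm c0 * norm (\<Sum>i\<in>{1..<k}. Z (k, Transposition.transpose i k \<circ> \<tau>))"
        using \<tau>(2) by (simp add: norm_mult)
      also have "\<dots> \<le> (1 / d) * (\<Sum>i\<in>{1..<k}. m)"
        by (intro mult_mono c sum_norm_le le solid_vertex \<tau>) auto
      also have "\<dots> = ((k - 1) / d) * m" by simp
      finally have *: "m \<le> ((k - 1) / d) * m" .
      have "real (k - 1) / d < 1" using k less.prems d by (simp add: field_simps of_nat_diff)
      have "m \<le> 0"
      proof (rule ccontr)
        assume "\<not> m \<le> 0"
        hence "((k - 1) / d) * m < 1 * m"
          using \<open>real (k - 1) / d < 1\<close> by (intro mult_strict_right_mono) auto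
        thus False using * by simp
      qed
      thus ?thesis using le[OF less.prems(1)] norm_ge_zero[of "Z (k, \<sigma>)"] by (simp only: norm_le_zero_iff[symmetric])
    qed
  qed
  hence "X (k, \<sigma>) = infsum (path_weight c0 c1 c2) (paths_from (k, \<sigma>))"
    using \<sigma> k by (simp add: Z_def)
  thus ?thesis using path_weight_summable[OF c d \<sigma> k] by simp
qed

section \<open>Moments of the symmetric space\<close>

lemma conj_transpose_mult:
  fixes A B :: "complex ^ 'n ^ 'n"
  shows "conj_transpose (A ** B) = conj_transpose B ** conj_transpose A"
  by (vector conj_transpose_def matrix_matrix_mult_def) (simp add: mult.commute)

text \<open>For square matrices a right inverse is also a left inverse.\<close>

lemma unitary_groupI:
  assumes "g ** conj_transpose g = mat 1"
  shows "g \<in> unitary_group"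
  using assms matrix_left_right_inverse[of g "conj_transpose g"] by (simp add: unitary_group_def)

lemma unitary_mult:
  assumes "g \<in> unitary_group" "h \<in> unitary_group"
  shows "g ** h \<in> unitary_group"
proof (rule unitary_groupI)
  have "(g ** h) ** conj_transpose (g ** h) = g ** (h ** conj_transpose h) ** conj_transpose g"
    by (simp add: conj_transpose_mult matrix_mul_assoc)
  thus "g ** h ** conj_transpose (g ** h) = mat 1"
    using assms by (simp add: unitary_group_def)
qed

lemma AIII_map_mult:
  "AIII_map e a (g ** h) = g ** AIII_map e a h ** conj_transpose g"
  by (simp add: AIII_map_def conj_transpose_mult matrix_mul_assoc)

text \<open>For row vectors this is the product of \<open>x\<close>, \<open>s\<close> and the
  conjugate transpose of \<open>y\<close>, linear in \<open>x\<close> and conjugate-linear in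
  \<open>y\<close>. It lets arbitrary vectors replace the row and column index of an entry.\<close>

definition sesq :: "complex ^ 'n ^ 'n \<Rightarrow> complex ^ 'n \<Rightarrow> complex ^ 'n \<Rightarrow> complex" where
  "sesq s x y = (\<Sum>j\<in>UNIV. (x v* s) $ j * cnj (y $ j))"

text \<open>Conjugation is moved from the matrix to the two vectors, so invariance of the measure
  will become invariance in the vectors.\<close>

lemma sesq_conj:
  fixes g s :: "complex ^ 'n ^ 'n"
  shows
  "sesq (g ** s ** conj_transpose g) x y = sesq s (x v* g) (y v* g)"
proof -
  have "(\<Sum>j\<in>UNIV. (z v* conj_transpose g) $ j * cnj (y $ j)) = (\<Sum>i\<in>UNIV. z $ i * cnj ((y v* g) $ i))"
    for z :: "complex ^ 'n"
    unfolding vector_matrix_mult_def conj_transpose_def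
    by (simp add: sum_distrib_left sum_distrib_right, subst sum.swap) (simp add: mult_ac)
  thus ?thesis by (simp add: sesq_def vector_matrix_mul_assoc[symmetric])
qed

lemma axis_vector_matrix: "axis i (1::complex) v* g = g $ i"
  by (simp add: vector_matrix_mult_def axis_def vec_eq_iff if_distrib if_distribR cong: if_cong)

lemma sesq_axis: "sesq s (axis i 1) (axis j 1) = s $ i $ j"
  unfolding sesq_def axis_vector_matrix by (simp add: axis_def if_distrib cong: if_cong)

lemma sesq_linear:
  "sesq s (c *s (x + x')) y = c * (sesq s x y + sesq s x' y)"
  "sesq s x (c *s (y + y')) = cnj c * (sesq s x y + sesq s x y')"
  by (simp_all add: sesq_def vector_matrix_mult_def sum_distrib_left sum_distrib_right
      sum.distrib algebra_simps)

lemma sesq_scale: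
  "sesq s (c *s x) y = c * sesq s x y"
  "sesq s x (c *s y) = cnj c * sesq s x y"
  by (simp_all add: sesq_def scalar_vector_matrix_assoc sum_distrib_left mult_ac)

text \<open>The rows of a unitary matrix are unit vectors. The crude bound serves to place the group
  in a compact ball.\<close>

lemma norm_unitary_le:
  fixes h :: "complex ^ 'n ^ 'n"
  assumes "h \<in> unitary_group"
  shows "norm h \<le> CARD('n)"
proof -
  have "norm (h $ i) = 1" for i
  proof -
    have "complex_of_real (\<Sum>j\<in>UNIV. (norm (h $ i $ j))\<^sup>2) = (h ** conj_transpose h) $ i $ i"
      by (simp add: matrix_matrix_mult_def conj_transpose_def complex_norm_square
          del: of_real_power)
    also have "\<dots> = 1" using assms by (simp add: unitary_group_def mat_def)
    finally have "(\<Sum>j\<in>UNIV. (norm (h $ i $ j))\<^sup>2) = 1" using of_real_eq_1_iff by blast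
    thus ?thesis by (simp add: norm_vec_def L2_set_def)
  qed
  moreover have "norm h \<le> (\<Sum>i\<in>UNIV. norm (h $ i))"
    unfolding norm_vec_def[of h] by (rule L2_set_le_sum) simp
  ultimately show ?thesis by simp
qed

lemma continuous_AIII_entry [continuous_intros]:
  fixes e :: "nat \<Rightarrow> 'n::finite"
  shows "continuous_on A (\<lambda>h. AIII_map e a h $ i $ j)"
  unfolding AIII_map_def matrix_matrix_mult_def conj_transpose_def vec_lambda_beta
  by (intro continuous_intros)

lemma continuous_sesq [continuous_intros]:
  fixes e :: "nat \<Rightarrow> 'n::finite"
  shows "continuous_on A (\<lambda>h. sesq (AIII_map e a h) x y)"
  unfolding sesq_def vector_matrix_mult_def vec_lambda_beta
  by (intro continuous_intros)

section \<open>Integration against Haar measure\<close>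

locale haar_unitary =
  fixes \<mu> :: "(complex ^ 'n ^ 'n) measure" and e :: "nat \<Rightarrow> 'n::finite" and a :: nat
  assumes haar: "is_haar_unitary \<mu>"
begin

sublocale prob_space \<mu>
  using haar by (simp add: is_haar_unitary_def)

lemma sets_haar: "sets \<mu> = sets (restrict_space borel unitary_group)"
  using haar by (simp add: is_haar_unitary_def)

lemma space_haar: "space \<mu> = unitary_group"
  using sets_eq_imp_space_eq[OF sets_haar] by (simp add: space_restrict_space)

lemma borel_measurable_continuous:
  fixes f :: "complex ^ 'n ^ 'n \<Rightarrow> 'b::topological_space"
  assumes "continuous_on UNIV f"
  shows "f \<in> borel_measurable \<mu>"
  using borel_measurable_continuous_onI[OF assms]
  by (simp add: measurable_restrict_space1 cong: measurable_cong_sets[OF sets_haar refl])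

text \<open>A continuous \<open>f\<close> is bounded on a compact ball containing the group, and the
  measure is finite.\<close>

lemma integrable_continuous:
  fixes f :: "complex ^ 'n ^ 'n \<Rightarrow> complex"
  assumes "continuous_on UNIV f"
  shows "integrable \<mu> f"
proof -
  have "compact (f ` cball 0 (real CARD('n)))"
    by (intro compact_continuous_image continuous_on_subset[OF assms]) auto
  then obtain B where B: "\<And>x. x \<in> f ` cball 0 (real CARD('n)) \<Longrightarrow> norm x \<le> B"
    using compact_imp_bounded bounded_iff by metis
  show ?thesis
  proof (rule integrable_const_bound)
    show "AE x in \<mu>. norm (f x) \<le> B"
      by (intro AE_I2 B) (simp add: space_haar norm_unitary_le)
  qed (rule borel_measurable_continuous[OF assms])
qed

text \<open>The slots hold vectors instead of indices, which makes multilinearity and rotations of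
  the basis available.\<close>

definition moment :: "nat set \<Rightarrow> (nat \<Rightarrow> complex ^ 'n) \<Rightarrow> (nat \<Rightarrow> complex ^ 'n) \<Rightarrow> complex" where
  "moment I x y = (LINT h | \<mu>. (\<Prod>i\<in>I. sesq (AIII_map e a h) (x i) (y i)))"

lemma moment_cong:
  "(\<And>i. i \<in> I \<Longrightarrow> x i = x' i) \<Longrightarrow> (\<And>i. i \<in> I \<Longrightarrow> y i = y' i) \<Longrightarrow> moment I x y = moment I x' y'"
  by (simp add: moment_def cong: prod.cong)

text \<open>The substitution of \<open>g ** h\<close> for \<open>h\<close> preserves Haar measure
  and conjugates \<open>s\<close> by \<open>g\<close>; \<open>sesq_conj\<close> then moves
  \<open>g\<close> onto the vectors.\<close>

lemma moment_invariant:
  assumes g: "g \<in> unitary_group"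
  shows "moment I (\<lambda>i. x i v* g) (\<lambda>i. y i v* g) = moment I x y"
proof -
  let ?f = "\<lambda>h. \<Prod>i\<in>I. sesq (AIII_map e a h) (x i) (y i)"
  have "continuous_on UNIV (\<lambda>h. g ** h)"
    unfolding matrix_matrix_mult_def by (intro continuous_intros)
  hence "(\<lambda>h. g ** h) \<in> borel_measurable \<mu>" by (rule borel_measurable_continuous)
  hence "(\<lambda>h. g ** h) \<in> measurable \<mu> (restrict_space borel unitary_group)"
    using unitary_mult[OF g] by (intro measurable_restrict_space2) (auto simp: space_haar)
  hence m: "(\<lambda>h. g ** h) \<in> measurable \<mu> \<mu>"
    using measurable_cong_sets[OF refl sets_haar] by blast
  have f: "?f \<in> borel_measurable \<mu>"
    by (intro borel_measurable_continuous continuous_intros)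
  have "moment I x y = integral\<^sup>L (distr \<mu> \<mu> (\<lambda>h. g ** h)) ?f"
    using haar g by (simp add: moment_def is_haar_unitary_def)
  also have "\<dots> = (LINT h | \<mu>. ?f (g ** h))"
    by (rule integral_distr[OF m f])
  finally show ?thesis by (simp add: moment_def AIII_map_mult sesq_conj)
qed

text \<open>Scalar and sum are treated together because the rotated basis vector to be expanded has
  the shape \<open>c *s (z + z')\<close>.\<close>

lemma moment_slot_left:
  assumes "finite I" "p \<in> I"
  shows "moment I (x(p := c *s (z + z'))) y = c * (moment I (x(p := z)) y + moment I (x(p := z')) y)"
proof -
  \<comment> \<open>Isolating the factor at \<open>p\<close> leaves a product free of
    \<open>w\<close>, so linearity of the integral applies.\<close>
  have *: "moment I (x(p := w)) y = (LINT h | \<mu>. sesq (AIII_map e a h) w (y p)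
      * (\<Prod>i\<in>I - {p}. sesq (AIII_map e a h) (x i) (y i)))" for w
    unfolding moment_def prod.remove[OF assms]
    by (intro Bochner_Integration.integral_cong refl arg_cong2[where f = times] prod.cong) auto
  show ?thesis
    unfolding * sesq_linear
    by (subst Bochner_Integration.integral_add[symmetric], (intro integrable_continuous continuous_intros)+,
        subst integral_mult_right_zero[symmetric]) (simp add: algebra_simps)
qed

lemma moment_slot_right:
  assumes "finite I" "p \<in> I"
  shows "moment I x (y(p := c *s (z + z'))) = cnj c * (moment I x (y(p := z)) + moment I x (y(p := z')))"
proof -
  have *: "moment I x (y(p := w)) = (LINT h | \<mu>. sesq (AIII_map e a h) (x p) w
      * (\<Prod>i\<in>I - {p}. sesq (AIII_map e a h) (x i) (y i)))" for w
    unfolding moment_def prod.remove[OF assms]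
    by (intro Bochner_Integration.integral_cong refl arg_cong2[where f = times] prod.cong) auto
  show ?thesis
    unfolding * sesq_linear
    by (subst Bochner_Integration.integral_add[symmetric], (intro integrable_continuous continuous_intros)+,
        subst integral_mult_right_zero[symmetric]) (simp add: algebra_simps)
qed

section \<open>Moments of matrix entries and their symmetries\<close>

definition entry_moment :: "nat set \<Rightarrow> (nat \<Rightarrow> 'n) \<Rightarrow> (nat \<Rightarrow> 'n) \<Rightarrow> complex" where
  "entry_moment I x y = moment I (\<lambda>i. axis (x i) 1) (\<lambda>i. axis (y i) 1)"

lemma entry_moment_eq: "entry_moment I x y = (LINT h | \<mu>. (\<Prod>i\<in>I. AIII_map e a h $ x i $ y i))"
  by (simp add: entry_moment_def moment_def sesq_axis)

lemma entry_moment_cong: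
  "(\<And>i. i \<in> I \<Longrightarrow> x i = x' i) \<Longrightarrow> (\<And>i. i \<in> I \<Longrightarrow> y i = y' i) \<Longrightarrow>
    entry_moment I x y = entry_moment I x' y'"
  unfolding entry_moment_def by (rule moment_cong) auto

text \<open>This is invariance under the permutation matrix \<open>g\<close>, whose row
  \<open>\<pi> i\<close> is the basis vector with index \<open>i\<close>.\<close>

lemma entry_moment_perm:
  assumes "bij \<pi>"
  shows "entry_moment I (\<lambda>i. \<pi> (x i)) (\<lambda>i. \<pi> (y i)) = entry_moment I x y"
proof -
  define g :: "complex ^ 'n ^ 'n" where "g = (\<chi> i j. if i = \<pi> j then 1 else 0)"
  have inj: "\<pi> i = \<pi> j \<longleftrightarrow> i = j" for i j using assms by (auto dest: bij_is_inj injD)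
  have "(conj_transpose g ** g) $ i $ j = (mat 1 :: complex ^ 'n ^ 'n) $ i $ j" for i j
  proof -
    have "(conj_transpose g ** g) $ i $ j = (\<Sum>k\<in>UNIV. if k = \<pi> i then g $ k $ j else 0)"
      unfolding matrix_matrix_mult_def conj_transpose_def vec_lambda_beta
      by (intro sum.cong refl) (simp add: g_def)
    thus ?thesis by (simp add: g_def mat_def inj)
  qed
  hence "conj_transpose g ** g = mat 1" by (simp only: vec_eq_iff) blast
  hence "g \<in> unitary_group"
    using matrix_left_right_inverse by (intro unitary_groupI) blast
  from moment_invariant[OF this, of I "\<lambda>i. axis (\<pi> (x i)) 1" "\<lambda>i. axis (\<pi> (y i)) 1"]
  have "entry_moment I (\<lambda>i. \<pi> (x i)) (\<lambda>i. \<pi> (y i)) = moment I (\<lambda>i. g $ \<pi> (x i)) (\<lambda>i. g $ \<pi> (y i))"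
    by (simp add: entry_moment_def axis_vector_matrix)
  moreover have "g $ \<pi> i = axis i 1" for i
    by (auto simp: g_def axis_def vec_eq_iff inj)
  ultimately show ?thesis by (simp add: entry_moment_def)
qed

text \<open>This is invariance under a diagonal unitary with the imaginary unit at \<open>v\<close>;
  a moment whose total phase is not 1 must vanish. Unlike -1, the imaginary unit also detects an
  excess of two between rows and columns equal to \<open>v\<close>.\<close>

lemma entry_moment_phase:
  fixes v :: 'n
  defines "t \<equiv> (\<lambda>i. if i = v then \<i> else 1)"
  shows "entry_moment I x y = (\<Prod>i\<in>I. t (x i)) * (\<Prod>i\<in>I. cnj (t (y i))) * entry_moment I x y"
proof -
  define g :: "complex ^ 'n ^ 'n" where "g = (\<chi> i j. if i = j then t i else 0)"
  have "(g ** conj_transpose g) $ i $ j = (mat 1 :: complex ^ 'n ^ 'n) $ i $ j" for i j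
  proof -
    have "(g ** conj_transpose g) $ i $ j = (\<Sum>k\<in>UNIV. if k = i then t i * cnj (g $ j $ k) else 0)"
      unfolding matrix_matrix_mult_def conj_transpose_def vec_lambda_beta
      by (intro sum.cong refl) (simp add: g_def)
    thus ?thesis by (simp add: g_def mat_def t_def)
  qed
  hence "g ** conj_transpose g = mat 1" by (simp only: vec_eq_iff) blast
  hence g: "g \<in> unitary_group" by (rule unitary_groupI)
  have row: "g $ i = t i *s axis i 1" for i
    by (auto simp: g_def axis_def vec_eq_iff)
  have s: "sesq s (g $ i) (g $ j) = t i * cnj (t j) * s $ i $ j" for s i j
    unfolding row sesq_scale sesq_axis by simp
  have "entry_moment I x y = moment I (\<lambda>i. g $ x i) (\<lambda>i. g $ y i)"
    using moment_invariant[OF g, of I "\<lambda>i. axis (x i) 1" "\<lambda>i. axis (y i) 1"]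
    by (simp add: entry_moment_def axis_vector_matrix)
  thus ?thesis by (simp add: moment_def entry_moment_eq s prod.distrib)
qed

lemma prod_fun_upd2:
  fixes f :: "'n \<Rightarrow> complex"
  assumes "finite I" "p \<in> I" "q \<in> I" "p \<noteq> q" "\<And>i. i \<in> I - {p, q} \<Longrightarrow> f (x i) = 1"
  shows "(\<Prod>i\<in>I. f ((x(p := v, q := w)) i)) = f v * f w"
proof -
  have "(\<Prod>i\<in>I. f ((x(p := v, q := w)) i)) = (\<Prod>i\<in>{p, q}. f ((x(p := v, q := w)) i))"
    using assms by (intro prod.mono_neutral_right) auto
  thus ?thesis using assms by simp
qed

text \<open>A Hadamard rotation of the plane spanned by the basis vectors \<open>u\<close> and \<open>v\<close> expresses the moment
  with \<open>u\<close> in all four slots through the sixteen moments with \<open>u\<close> or \<open>v\<close> in each slot. Of these,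
  a diagonal unitary kills the ten in which \<open>v\<close> is not as often a row as a column.\<close>

lemma entry_moment_coincide:
  assumes I: "finite I" "p \<in> I" "q \<in> I" "p \<noteq> q" "P \<in> I" "Q \<in> I" "P \<noteq> Q" and uv: "u \<noteq> v"
    and x: "\<And>i. i \<in> I - {p, q} \<Longrightarrow> x i \<noteq> u \<and> x i \<noteq> v"
    and y: "\<And>i. i \<in> I - {P, Q} \<Longrightarrow> y i \<noteq> u \<and> y i \<noteq> v"
  shows "entry_moment I (x(p := u, q := u)) (y(P := u, Q := u)) =
    entry_moment I (x(p := u, q := v)) (y(P := u, Q := v)) +
    entry_moment I (x(p := u, q := v)) (y(P := v, Q := u))"
proof -
  \<comment> \<open>\<open>G\<close> extends \<open>H\<close> from basis vectors to arbitrary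
    vectors in the four distinguished slots, where it can be expanded.\<close>
  define G where "G = (\<lambda>z1 z2 z3 z4. moment I ((\<lambda>i. axis (x i) 1)(p := z1, q := z2))
    ((\<lambda>i. axis (y i) 1)(P := z3, Q := z4)))"
  define H where "H = (\<lambda>i1 i2 i3 i4. entry_moment I (x(p := i1, q := i2)) (y(P := i3, Q := i4)))"
  have GH: "G (axis i1 1) (axis i2 1) (axis i3 1) (axis i4 1) = H i1 i2 i3 i4" for i1 i2 i3 i4
    unfolding G_def H_def entry_moment_def by (rule moment_cong) auto
  have lin: "G (c *s (z + z')) z2 z3 z4 = c * (G z z2 z3 z4 + G z' z2 z3 z4)"
    "G z1 (c *s (z + z')) z3 z4 = c * (G z1 z z3 z4 + G z1 z' z3 z4)"
    "G z1 z2 (c *s (z + z')) z4 = cnj c * (G z1 z2 z z4 + G z1 z2 z' z4)"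
    "G z1 z2 z3 (c *s (z + z')) = cnj c * (G z1 z2 z3 z + G z1 z2 z3 z')" for c z z' z1 z2 z3 z4
  proof -
    show "G (c *s (z + z')) z2 z3 z4 = c * (G z z2 z3 z4 + G z' z2 z3 z4)"
      unfolding G_def fun_upd_twist[OF \<open>p \<noteq> q\<close>] by (rule moment_slot_left[OF I(1,2)])
    show "G z1 (c *s (z + z')) z3 z4 = c * (G z1 z z3 z4 + G z1 z' z3 z4)"
      unfolding G_def by (rule moment_slot_left[OF I(1,3)])
    show "G z1 z2 (c *s (z + z')) z4 = cnj c * (G z1 z2 z z4 + G z1 z2 z' z4)"
      unfolding G_def fun_upd_twist[OF \<open>P \<noteq> Q\<close>] by (rule moment_slot_right[OF I(1,5)])
    show "G z1 z2 z3 (c *s (z + z')) = cnj c * (G z1 z2 z3 z + G z1 z2 z3 z')"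
      unfolding G_def by (rule moment_slot_right[OF I(1,6)])
  qed
  define t where "t = (\<lambda>i. if i = v then \<i> else 1)"
  have phase: "H i1 i2 i3 i4 = 0" if "t i1 * t i2 * (cnj (t i3) * cnj (t i4)) \<noteq> 1" for i1 i2 i3 i4
  proof -
    have 1: "(\<Prod>i\<in>I. t ((x(p := i1, q := i2)) i)) = t i1 * t i2"
      using I x by (intro prod_fun_upd2) (auto simp: t_def)
    have 2: "(\<Prod>i\<in>I. cnj (t ((y(P := i3, Q := i4)) i))) = cnj (t i3) * cnj (t i4)"
      using I y by (intro prod_fun_upd2[where f = "\<lambda>i. cnj (t i)"]) (auto simp: t_def)
    have "H i1 i2 i3 i4 = (\<Prod>i\<in>I. t ((x(p := i1, q := i2)) i)) *
        (\<Prod>i\<in>I. cnj (t ((y(P := i3, Q := i4)) i))) * H i1 i2 i3 i4"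
      unfolding H_def t_def by (rule entry_moment_phase)
    hence "H i1 i2 i3 i4 = t i1 * t i2 * (cnj (t i3) * cnj (t i4)) * H i1 i2 i3 i4"
      unfolding 1 2 .
    thus ?thesis using that by (metis mult_cancel_right1)
  qed
  \<comment> \<open>The imbalance of \<open>v\<close> between two row and two column slots is 1 or 2
    in absolute value here, so the phase is never 1.\<close>
  have zero: "H u u u v = 0" "H u u v u = 0" "H u u v v = 0" "H u v u u = 0" "H v u u u = 0"
    "H v v u u = 0" "H v v v u = 0" "H v v u v = 0" "H u v v v = 0" "H v u v v = 0"
    by (rule phase; simp add: t_def complex_eq_iff uv uv[symmetric])+
  \<comment> \<open>Exchanging \<open>u\<close> and \<open>v\<close> pairs the six surviving
    moments, which leaves three unknowns.\<close>
  have swap: "H i1 i2 i3 i4 = H (Transposition.transpose u v i1) (Transposition.transpose u v i2)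
      (Transposition.transpose u v i3) (Transposition.transpose u v i4)" for i1 i2 i3 i4
  proof -
    let ?\<pi> = "Transposition.transpose u v"
    have "H i1 i2 i3 i4 = entry_moment I (\<lambda>i. ?\<pi> ((x(p := i1, q := i2)) i))
        (\<lambda>i. ?\<pi> ((y(P := i3, Q := i4)) i))"
      unfolding H_def by (rule entry_moment_perm[symmetric]) simp
    also have "\<dots> = H (?\<pi> i1) (?\<pi> i2) (?\<pi> i3) (?\<pi> i4)"
      unfolding H_def by (rule entry_moment_cong) (use x y in auto)
    finally show ?thesis .
  qed
  have sw: "H v v v v = H u u u u" "H v u v u = H u v u v" "H v u u v = H u v v u"
    using swap[of v v v v] swap[of v u v u] swap[of v u u v] by simp_all
  define c where "c = complex_of_real (1 / sqrt 2)"
  have c: "c * c = 1 / 2" "cnj c = c"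
    by (simp_all add: c_def flip: of_real_mult)
  define g :: "complex ^ 'n ^ 'n" where
    "g = (\<chi> i. if i = u then c *s (axis u 1 + axis v 1)
      else if i = v then c *s (axis u 1 - axis v 1) else axis i 1)"
  have g: "g \<in> unitary_group"
  proof (rule unitary_groupI)
    \<comment> \<open>\<open>g\<close> is real and symmetric, so unitarity reduces to
      \<open>g\<close> being an involution.\<close>
    have "g ** conj_transpose g = g ** g"
      using c uv by (intro arg_cong2[where f = "(**)"]) (auto simp: g_def conj_transpose_def vec_eq_iff axis_def)
    moreover have "(g ** g) $ i = axis i 1" for i
    proof -
      have row: "g $ u = c *s (axis u 1 + axis v 1)" "g $ v = c *s (axis u 1 - axis v 1)"
        using uv by (simp_all add: g_def)
      have "(g ** g) $ i = g $ i v* g"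
        by (simp add: vec_eq_iff matrix_matrix_mult_def vector_matrix_mult_def)
      also have "\<dots> = axis i 1"
      proof -
        consider "i = u" | "i = v" | "i \<noteq> u" "i \<noteq> v" by blast
        thus ?thesis
        proof cases
          case 1
          have "g $ u v* g = c *s (g $ u + g $ v)"
            by (subst row(1)) (simp only: scalar_vector_matrix_assoc vector_matrix_left_distrib
                axis_vector_matrix)
          also have "\<dots> = (c * c * 2) *s axis u 1"
            unfolding row by (simp add: vec_eq_iff algebra_simps)
          finally show ?thesis using 1 c by simp
        next
          case 2
          have "g $ v v* g = c *s (g $ u - g $ v)"
            by (subst row(2)) (simp only: scalar_vector_matrix_assoc vector_matrix_mult_diff_distrib
                axis_vector_matrix)
          also have "\<dots> = (c * c * 2) *s axis v 1"
            unfolding row by (simp add: vec_eq_iff algebra_simps)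
          finally show ?thesis using 2 c by simp
        next
          case 3
          hence "g $ i = axis i 1" by (simp add: g_def)
          thus ?thesis by (simp add: axis_vector_matrix)
        qed
      qed
      finally show ?thesis .
    qed
    ultimately show "g ** conj_transpose g = mat 1"
      by (simp only: vec_eq_iff) (simp add: axis_def mat_def)
  qed
  let ?w = "c *s (axis u 1 + axis v 1)"
  \<comment> \<open>Row \<open>u\<close> of \<open>g\<close> fills the four slots; all other slots
    are unchanged because their indices avoid \<open>u\<close> and \<open>v\<close>.\<close>
  have "H u u u u = G ?w ?w ?w ?w"
  proof -
    have "H u u u u = moment I (\<lambda>i. axis ((x(p := u, q := u)) i) 1 v* g)
        (\<lambda>i. axis ((y(P := u, Q := u)) i) 1 v* g)"
      by (simp only: H_def entry_moment_def moment_invariant[OF g])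
    also have "\<dots> = G ?w ?w ?w ?w"
      unfolding G_def axis_vector_matrix by (rule moment_cong) (use x y in \<open>auto simp: g_def\<close>)
    finally show ?thesis .
  qed
  also have "\<dots> = c * c * (c * c) * (2 * H u u u u + 2 * H u v u v + 2 * H u v v u)"
    unfolding lin GH c(2) by (simp add: zero sw algebra_simps)
  finally have eq: "H u u u u = c * c * (c * c) * (2 * H u u u u + 2 * H u v u v + 2 * H u v v u)" .
  \<comment> \<open>Since \<open>c\<close> has fourth power 1/4, the expansion says that
    \<open>H u u u u\<close> is half of itself plus half of the two mixed moments.\<close>
  have "H u u u u - c * c * (c * c) * (2 * H u u u u + 2 * H u v u v + 2 * H u v v u) =
      (H u u u u - (H u v u v + H u v v u)) / 2"
    unfolding c(1) by (simp add: field_simps)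
  hence "H u u u u = H u v u v + H u v v u"
    using eq by simp
  thus ?thesis by (simp add: H_def)
qed

end

section \<open>The Weingarten recurrence\<close>

text \<open>The matrix is a unitary conjugate of a diagonal matrix of signs.\<close>

lemma AIII_map_square:
  fixes e :: "nat \<Rightarrow> 'n::finite"
  assumes "h \<in> unitary_group"
  shows "AIII_map e a h ** AIII_map e a h = mat 1"
proof -
  have "(signature_mat e a ** signature_mat e a) $ i $ j = (mat 1 :: complex ^ 'n ^ 'n) $ i $ j" for i j
  proof -
    have "(signature_mat e a ** signature_mat e a) $ i $ j =
        (\<Sum>k\<in>UNIV. if k = i then (signature_mat e a $ i $ i) * (signature_mat e a $ i $ j) else 0)"
      unfolding matrix_matrix_mult_def vec_lambda_beta
      by (intro sum.cong refl) (simp add: signature_mat_def)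
    thus ?thesis by (simp add: signature_mat_def mat_def)
  qed
  hence "signature_mat e a ** signature_mat e a = (mat 1 :: complex ^ 'n ^ 'n)"
    by (simp only: vec_eq_iff) blast
  moreover have "AIII_map e a h ** AIII_map e a h =
      h ** (signature_mat e a ** (conj_transpose h ** h) ** signature_mat e a) ** conj_transpose h"
    by (simp add: AIII_map_def matrix_mul_assoc)
  ultimately show ?thesis using assms by (simp add: unitary_group_def)
qed

text \<open>Cyclicity of the trace removes \<open>h\<close>; the signs are then counted through the
  numbering \<open>e\<close>.\<close>

lemma trace_AIII_map:
  fixes e :: "nat \<Rightarrow> 'n::finite"
  assumes "h \<in> unitary_group" "bij_betw e {1..a + b} UNIV"
  shows "trace (AIII_map e a h) = of_int (int a - int b)"
proof -
  have "trace (AIII_map e a h) = trace (conj_transpose h ** (h ** signature_mat e a))"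
    unfolding AIII_map_def by (rule trace_mul_sym)
  also have "conj_transpose h ** (h ** signature_mat e a) = signature_mat e a"
    using assms(1) by (simp add: matrix_mul_assoc unitary_group_def)
  also have "trace (signature_mat e a) = (\<Sum>i\<in>UNIV. if i \<in> e ` {1..a} then 1 else -1)"
    by (simp add: trace_def signature_mat_def)
  also have "\<dots> = (\<Sum>j\<in>{1..a + b}. if e j \<in> e ` {1..a} then 1 else -1)"
    by (rule sum.reindex_bij_betw[OF assms(2), symmetric])
  also have "\<dots> = (\<Sum>j\<in>{1..a + b}. if j \<in> {1..a} then 1 else -1)"
  proof (intro sum.cong refl if_cong)
    fix j assume "j \<in> {1..a + b}"
    thus "e j \<in> e ` {1..a} \<longleftrightarrow> j \<in> {1..a}"
      using bij_betw_imp_inj_on[OF assms(2)] by (intro inj_on_image_mem_iff) auto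
  qed
  also have "\<dots> = (\<Sum>j\<in>{1..a}. 1) + (\<Sum>j\<in>{a + 1..a + b}. -1)"
    by (subst sum.ub_add_nat) (auto intro!: arg_cong2[where f = "(+)"] sum.cong)
  finally show ?thesis by simp
qed

text \<open>The complements of \<open>A\<close> and of its image are finite of equal size. The
  extension makes a partial renaming of indices accessible to
  \<open>entry_moment_perm\<close>.\<close>

lemma bij_extend:
  fixes f :: "'n::finite \<Rightarrow> 'n"
  assumes "inj_on f A"
  obtains \<pi> where "bij \<pi>" "\<And>i. i \<in> A \<Longrightarrow> \<pi> i = f i"
proof -
  have "card (- A) = card (- f ` A)"
    using card_image[OF assms] by (simp add: Compl_eq_Diff_UNIV card_Diff_subset)
  then obtain g where g: "bij_betw g (- A) (- f ` A)"
    using finite_same_card_bij[of "- A" "- f ` A"] by auto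
  have "bij_betw (\<lambda>i. if i \<in> A then f i else g i) (A \<union> - A) (f ` A \<union> - f ` A)"
    by (rule bij_betw_disjoint_Un[OF inj_on_imp_bij_betw[OF assms] g]) auto
  hence "bij (\<lambda>i. if i \<in> A then f i else g i)" by simp
  thus ?thesis by (rule that) simp
qed

section \<open>Moments along the arrows of the graph\<close>

context haar_unitary
begin

text \<open>A single change of variables pulls the integral back from the symmetric space to the
  unitary group.\<close>

lemma Wg_AIII_eq_entry_moment: "Wg_AIII \<mu> e a k \<sigma> = entry_moment {1..k} e (e \<circ> \<sigma>)"
proof -
  have "continuous_on UNIV (\<lambda>h. \<chi> i j. AIII_map e a h $ i $ j)"
    by (intro continuous_intros)
  hence "continuous_on UNIV (AIII_map e a)" by simp
  hence "AIII_map e a \<in> borel_measurable \<mu>"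
    by (rule borel_measurable_continuous)
  hence m: "AIII_map e a \<in> measurable \<mu> (restrict_space borel (AIII_space e a))"
    by (intro measurable_restrict_space2) (auto simp: space_haar AIII_space_def)
  have "(\<lambda>s::complex ^ 'n ^ 'n. \<Prod>i = 1..k. s $ e i $ e (\<sigma> i)) \<in> borel_measurable borel"
    by (intro borel_measurable_continuous_onI continuous_intros)
  hence f: "(\<lambda>s::complex ^ 'n ^ 'n. \<Prod>i = 1..k. s $ e i $ e (\<sigma> i))
      \<in> borel_measurable (restrict_space borel (AIII_space e a))"
    by (rule measurable_restrict_space1)
  show ?thesis
    unfolding Wg_AIII_def AIII_measure_def entry_moment_eq integral_distr[OF m f] by simp
qed

text \<open>A moment depends only on the coincidence pattern of its indices. Transported through
  \<open>e\<close>, the map \<open>f\<close> is a partial injection of the index type, and its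
  extension to a bijection is a symmetry. Squiggled arrows need this to close the gap left in the
  index set.\<close>

lemma entry_moment_relabel:
  assumes T: "T \<subseteq> {1..d}" and e: "inj_on e {1..d}"
    and f: "bij_betw f T T'" "T' \<subseteq> {1..d}"
    and \<sigma>: "\<And>i. i \<in> T \<Longrightarrow> \<sigma> i \<in> T" and \<tau>: "\<And>i. i \<in> T \<Longrightarrow> \<tau> (f i) = f (\<sigma> i)"
  shows "entry_moment T' e (e \<circ> \<tau>) = entry_moment T e (e \<circ> \<sigma>)"
proof -
  have eT: "inj_on e T" using e T by (rule inj_on_subset)
  have "inj_on (e \<circ> f \<circ> inv_into T e) (e ` T)"
  proof (intro comp_inj_on inj_on_inv_into)
    show "inj_on e (f ` inv_into T e ` e ` T)"
      using e f T eT by (auto simp: bij_betw_def intro: inj_on_subset)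
    show "inj_on f (inv_into T e ` e ` T)" using f eT by (auto simp: bij_betw_def)
  qed auto
  then obtain \<pi> where \<pi>: "bij \<pi>" "\<And>i. i \<in> e ` T \<Longrightarrow> \<pi> i = (e \<circ> f \<circ> inv_into T e) i"
    using bij_extend by blast
  hence \<pi>e: "\<pi> (e i) = e (f i)" if "i \<in> T" for i using that eT by simp
  have "entry_moment T' e (e \<circ> \<tau>) = entry_moment T (\<lambda>i. e (f i)) (\<lambda>i. e (\<tau> (f i)))"
    unfolding entry_moment_eq
    by (intro Bochner_Integration.integral_cong refl, subst prod.reindex_bij_betw[OF f(1), symmetric]) simp
  also have "\<dots> = entry_moment T (\<lambda>i. \<pi> (e i)) (\<lambda>i. \<pi> (e (\<sigma> i)))"
    using \<sigma> by (intro entry_moment_cong) (simp_all add: \<pi>e \<tau>)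
  also have "\<dots> = entry_moment T e (e \<circ> \<sigma>)"
    using entry_moment_perm[OF \<pi>(1), of T e "e \<circ> \<sigma>"] by simp
  finally show ?thesis .
qed

text \<open>Replace the row index \<open>k\<close> and the column index \<open>k\<close> by \<open>j\<close> and sum over \<open>j\<close>. For \<open>j \<ge> k\<close>
  this only renames an index; for \<open>j < k\<close> the index \<open>j\<close> becomes double.\<close>

lemma Wg_AIII_sum:
  assumes e: "inj_on e {1..d}" and k: "1 \<le> k" "k \<le> d" and \<sigma>: "\<sigma> permutes {1..k}"
  shows "(\<Sum>j\<in>{1..d}. entry_moment {1..k} (e \<circ> id(k := j)) (e \<circ> (id(k := j) \<circ> \<sigma>))) =
    of_nat d * Wg_AIII \<mu> e a k \<sigma> +
    (\<Sum>j\<in>{1..<k}. Wg_AIII \<mu> e a k (Transposition.transpose j k \<circ> \<sigma>))"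
proof -
  define F where "F = (\<lambda>j. entry_moment {1..k} (e \<circ> id(k := j)) (e \<circ> (id(k := j) \<circ> \<sigma>)))"
  let ?I = "{1..k}" and ?t = "\<lambda>j. Transposition.transpose j k"
  have in_I: "\<sigma> i \<in> ?I \<longleftrightarrow> i \<in> ?I" for i by (rule permutes_in_image[OF \<sigma>])
  have e_eq: "e i = e j \<longleftrightarrow> i = j" if "i \<in> {1..d}" "j \<in> {1..d}" for i j
    using e that by (auto dest: inj_onD)
  \<comment> \<open>For \<open>j > k\<close> the index \<open>j\<close> occurs nowhere in the
    moment, so exchanging it with \<open>k\<close> is a mere renaming; for \<open>j = k\<close>
    nothing changes.\<close>
  have ge: "F j = Wg_AIII \<mu> e a k \<sigma>" if j: "j \<in> {k..d}" for j
  proof -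
    let ?\<pi> = "Transposition.transpose (e k) (e j)"
    have *: "?\<pi> (e i) = e ((id(k := j)) i)" if "i \<in> ?I" for i
    proof (cases "i = k")
      case False
      hence "e i \<noteq> e k" "e i \<noteq> e j" using that k j by (subst e_eq; auto)+
      thus ?thesis using False by simp
    qed simp
    have "F j = entry_moment ?I (\<lambda>i. ?\<pi> (e i)) (\<lambda>i. ?\<pi> ((e \<circ> \<sigma>) i))"
      unfolding F_def
    proof (rule entry_moment_cong)
      fix i assume i: "i \<in> ?I"
      show "(e \<circ> id(k := j)) i = ?\<pi> (e i)" using *[OF i] by simp
      show "(e \<circ> (id(k := j) \<circ> \<sigma>)) i = ?\<pi> ((e \<circ> \<sigma>) i)"
        using *[of "\<sigma> i"] i in_I[of i] by simp
    qed
    also have "\<dots> = entry_moment ?I e (e \<circ> \<sigma>)" by (rule entry_moment_perm) simp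
    finally show ?thesis by (simp add: Wg_AIII_eq_entry_moment)
  qed
  have less: "F j = Wg_AIII \<mu> e a k \<sigma> + Wg_AIII \<mu> e a k (?t j \<circ> \<sigma>)" if j: "j \<in> {1..<k}" for j
  proof -
    \<comment> \<open>\<open>P\<close> and \<open>Q\<close> are the positions whose column indices
      are \<open>j\<close> and \<open>k\<close>; the corresponding row positions are
      \<open>j\<close> and \<open>k\<close> themselves. Of the two mixed moments, one restores
      \<sigma> and the other swaps its values \<open>j\<close> and \<open>k\<close>.\<close>
    define P Q where "P = inv \<sigma> j" and "Q = inv \<sigma> k"
    have PQ: "\<sigma> P = j" "\<sigma> Q = k" "\<sigma> i = j \<longleftrightarrow> i = P" "\<sigma> i = k \<longleftrightarrow> i = Q" for i
      using permutes_inverses[OF \<sigma>] by (auto simp: P_def Q_def)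
    have "P \<in> ?I" "Q \<in> ?I" using in_I[of P] in_I[of Q] PQ j k by auto
    moreover have "P \<noteq> Q"
      using PQ(1,2) j by (metis atLeastLessThan_iff less_irrefl)
    moreover have "e j \<noteq> e k" using j k by (subst e_eq) auto
    moreover have "e i \<noteq> e j \<and> e i \<noteq> e k" if "i \<in> ?I - {j, k}" for i
      using that j k by (subst (1 2) e_eq) auto
    moreover have "(e \<circ> \<sigma>) i \<noteq> e j \<and> (e \<circ> \<sigma>) i \<noteq> e k" if i: "i \<in> ?I - {P, Q}" for i
    proof -
      have "\<sigma> i \<in> {1..d}" using i in_I[of i] k by auto
      thus ?thesis using i j k by (simp add: e_eq PQ)
    qed
    ultimately have "entry_moment ?I (e(j := e j, k := e j)) ((e \<circ> \<sigma>)(P := e j, Q := e j)) =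
      entry_moment ?I (e(j := e j, k := e k)) ((e \<circ> \<sigma>)(P := e j, Q := e k)) +
      entry_moment ?I (e(j := e j, k := e k)) ((e \<circ> \<sigma>)(P := e k, Q := e j))"
      using j by (intro entry_moment_coincide) auto
    moreover have "e(j := e j, k := e j) = e \<circ> id(k := j)" "e(j := e j, k := e k) = e"
      by auto
    moreover have "(e \<circ> \<sigma>)(P := e j, Q := e j) = e \<circ> (id(k := j) \<circ> \<sigma>)"
      "(e \<circ> \<sigma>)(P := e j, Q := e k) = e \<circ> \<sigma>"
      "(e \<circ> \<sigma>)(P := e k, Q := e j) = e \<circ> (?t j \<circ> \<sigma>)"
      using \<open>P \<noteq> Q\<close> by (auto simp: fun_eq_iff transpose_def PQ)
    ultimately show ?thesis
      by (simp only: F_def Wg_AIII_eq_entry_moment)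
  qed
  have "{1..d} = {1..<k} \<union> {k..d}" using k by auto
  hence "(\<Sum>j\<in>{1..d}. F j) = (\<Sum>j\<in>{1..<k}. F j) + (\<Sum>j\<in>{k..d}. F j)"
    by (simp only:) (rule sum.union_disjoint, auto)
  also have "\<dots> = (\<Sum>j\<in>{1..<k}. Wg_AIII \<mu> e a k \<sigma> + Wg_AIII \<mu> e a k (?t j \<circ> \<sigma>))
      + (\<Sum>j\<in>{k..d}. Wg_AIII \<mu> e a k \<sigma>)"
    by (intro arg_cong2[where f = "(+)"] sum.cong refl ge less)
  also have "\<dots> = (of_nat (k - 1) + of_nat (Suc d - k)) * Wg_AIII \<mu> e a k \<sigma> +
    (\<Sum>j\<in>{1..<k}. Wg_AIII \<mu> e a k (?t j \<circ> \<sigma>))"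
    by (simp add: sum.distrib algebra_simps)
  \<comment> \<open>Each of the \<open>d\<close> choices of \<open>j\<close> contributes one copy of
    the original moment.\<close>
  also have "of_nat (k - 1) + of_nat (Suc d - k) = (of_nat d :: complex)"
    using k by (simp flip: of_nat_add)
  finally show ?thesis unfolding F_def .
qed

text \<open>The sum in \<open>Wg_AIII_sum\<close> is now evaluated pointwise. If \<sigma> fixes
  \<open>k\<close>, the diagonal entries add up to the trace. Otherwise the two factors containing
  \<open>j\<close> add up to an entry of the square of the matrix, hence to 1 if \<sigma> swaps
  \<open>k\<close> with \<open>\<sigma> k\<close> and to 0 if not.\<close>

lemma Wg_AIII_rec:
  assumes e: "bij_betw e {1..a + b} UNIV" and k: "1 \<le> k" "k \<le> a + b" and \<sigma>: "\<sigma> permutes {1..k}"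
  shows "of_nat (a + b) * Wg_AIII \<mu> e a k \<sigma> +
    (\<Sum>j\<in>{1..<k}. Wg_AIII \<mu> e a k (Transposition.transpose j k \<circ> \<sigma>)) =
    (if \<sigma> k = k then of_int (int a - int b) * Wg_AIII \<mu> e a (k - 1) \<sigma>
     else if \<sigma> (\<sigma> k) = k then Wg_AIII \<mu> e a (k - 2) (perm_flat k \<sigma>) else 0)"
proof -
  have inj: "inj_on e {1..a + b}" using e by (rule bij_betw_imp_inj_on)
  have in_I: "\<sigma> i \<in> {1..k} \<longleftrightarrow> i \<in> {1..k}" for i by (rule permutes_in_image[OF \<sigma>])
  let ?s = "AIII_map e a"
  define P where "P = (\<lambda>T h. \<Prod>i\<in>T. ?s h $ e i $ e (\<sigma> i))"
  have P: "(LINT h | \<mu>. P T h) = entry_moment T e (e \<circ> \<sigma>)" for T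
    by (simp add: P_def entry_moment_eq)
  have "(\<Sum>j\<in>{1..a + b}. entry_moment {1..k} (e \<circ> id(k := j)) (e \<circ> (id(k := j) \<circ> \<sigma>))) =
    (LINT h | \<mu>. (\<Sum>j\<in>{1..a + b}.
       \<Prod>i\<in>{1..k}. ?s h $ e ((id(k := j)) i) $ e ((id(k := j)) (\<sigma> i))))"
    unfolding entry_moment_eq
    by (subst Bochner_Integration.integral_sum) (auto intro!: integrable_continuous continuous_intros)
  also have "\<dots> =
    (if \<sigma> k = k then of_int (int a - int b) * Wg_AIII \<mu> e a (k - 1) \<sigma>
     else if \<sigma> (\<sigma> k) = k then Wg_AIII \<mu> e a (k - 2) (perm_flat k \<sigma>) else 0)"
  proof (cases "\<sigma> k = k")
    case True
    have "(\<Sum>j\<in>{1..a + b}. \<Prod>i\<in>{1..k}. ?s h $ e ((id(k := j)) i) $ e ((id(k := j)) (\<sigma> i)))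
        = of_int (int a - int b) * P {1..k - 1} h" if h: "h \<in> space \<mu>" for h
    proof -
      have "(\<Prod>i\<in>{1..k}. ?s h $ e ((id(k := j)) i) $ e ((id(k := j)) (\<sigma> i)))
          = ?s h $ e j $ e j * P {1..k - 1} h" for j
      proof -
        have "{1..k} = insert k {1..k - 1}" using k by auto
        moreover have "\<sigma> i = k \<longleftrightarrow> i = k" for i
          using True permutes_inj[OF \<sigma>] by (metis injD)
        ultimately show ?thesis using k True by (auto simp: P_def intro!: prod.cong)
      qed
      hence "(\<Sum>j\<in>{1..a + b}. \<Prod>i\<in>{1..k}. ?s h $ e ((id(k := j)) i) $ e ((id(k := j)) (\<sigma> i)))
          = (\<Sum>j\<in>{1..a + b}. ?s h $ e j $ e j) * P {1..k - 1} h"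
        by (simp add: sum_distrib_right)
      also have "(\<Sum>j\<in>{1..a + b}. ?s h $ e j $ e j) = trace (?s h)"
        unfolding trace_def by (rule sum.reindex_bij_betw[OF e])
      also have "\<dots> = of_int (int a - int b)"
        using h e by (intro trace_AIII_map) (simp_all add: space_haar)
      finally show ?thesis .
    qed
    thus ?thesis using True
      by (simp add: P Wg_AIII_eq_entry_moment cong: Bochner_Integration.integral_cong)
  next
    case False
    \<comment> \<open>Here \<open>r\<close> is the row paired with column \<open>k\<close>. It
      agrees with the \<open>r\<close> of \<open>perm_flat\<close>, namely
      \<open>\<sigma> k\<close>, exactly in the squiggled case.\<close>
    define r where "r = inv \<sigma> k"
    have r: "\<sigma> i = k \<longleftrightarrow> i = r" for i
      using permutes_inverses[OF \<sigma>] by (auto simp: r_def)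
    have "\<sigma> r = k" by (simp only: r)
    hence rk: "r \<noteq> k" "r \<in> {1..k}" using False in_I[of r] k by auto
    have "(\<Sum>j\<in>{1..a + b}. \<Prod>i\<in>{1..k}. ?s h $ e ((id(k := j)) i) $ e ((id(k := j)) (\<sigma> i)))
        = (if \<sigma> k = r then 1 else 0) * P ({1..k} - {k, r}) h" if h: "h \<in> space \<mu>" for h
    proof -
      have "(\<Prod>i\<in>{1..k}. ?s h $ e ((id(k := j)) i) $ e ((id(k := j)) (\<sigma> i)))
          = ?s h $ e r $ e j * ?s h $ e j $ e (\<sigma> k) * P ({1..k} - {k, r}) h" for j
      proof -
        have "{1..k} = insert k (insert r ({1..k} - {k, r}))" using k rk by auto
        hence "(\<Prod>i\<in>{1..k}. ?s h $ e ((id(k := j)) i) $ e ((id(k := j)) (\<sigma> i)))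
          = (\<Prod>i\<in>insert k (insert r ({1..k} - {k, r})).
              ?s h $ e ((id(k := j)) i) $ e ((id(k := j)) (\<sigma> i)))" by (rule arg_cong)
        also have "\<dots> = ?s h $ e r $ e j * ?s h $ e j $ e (\<sigma> k) *
            (\<Prod>i\<in>{1..k} - {k, r}. ?s h $ e ((id(k := j)) i) $ e ((id(k := j)) (\<sigma> i)))"
          using rk r False by simp
        also have "(\<Prod>i\<in>{1..k} - {k, r}. ?s h $ e ((id(k := j)) i) $ e ((id(k := j)) (\<sigma> i)))
            = P ({1..k} - {k, r}) h"
          unfolding P_def by (rule prod.cong) (auto simp: r)
        finally show ?thesis .
      qed
      hence "(\<Sum>j\<in>{1..a + b}. \<Prod>i\<in>{1..k}. ?s h $ e ((id(k := j)) i) $ e ((id(k := j)) (\<sigma> i)))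
          = (\<Sum>j\<in>{1..a + b}. ?s h $ e r $ e j * ?s h $ e j $ e (\<sigma> k)) * P ({1..k} - {k, r}) h"
        by (simp add: sum_distrib_right)
      also have "(\<Sum>j\<in>{1..a + b}. ?s h $ e r $ e j * ?s h $ e j $ e (\<sigma> k))
          = (?s h ** ?s h) $ e r $ e (\<sigma> k)"
        unfolding matrix_matrix_mult_def vec_lambda_beta by (rule sum.reindex_bij_betw[OF e])
      also have "\<dots> = (if \<sigma> k = r then 1 else 0)"
      proof -
        have "r \<in> {1..a + b}" "\<sigma> k \<in> {1..a + b}" using rk in_I[of k] k by auto
        hence "e r = e (\<sigma> k) \<longleftrightarrow> \<sigma> k = r" using inj by (auto dest: inj_onD)
        thus ?thesis using h AIII_map_square[of h e a] by (simp add: space_haar mat_def)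
      qed
      finally show ?thesis .
    qed
    hence "(LINT h | \<mu>. (\<Sum>j\<in>{1..a + b}.
        \<Prod>i\<in>{1..k}. ?s h $ e ((id(k := j)) i) $ e ((id(k := j)) (\<sigma> i))))
      = (LINT h | \<mu>. (if \<sigma> k = r then 1 else 0) * P ({1..k} - {k, r}) h)"
      by (intro Bochner_Integration.integral_cong refl)
    also have "\<dots> = (if \<sigma> k = r then entry_moment ({1..k} - {k, r}) e (e \<circ> \<sigma>) else 0)"
      by (simp add: P)
    also have "\<dots> = (if \<sigma> (\<sigma> k) = k then Wg_AIII \<mu> e a (k - 2) (perm_flat k \<sigma>) else 0)"
    proof (rule if_cong)
      show "\<sigma> k = r \<longleftrightarrow> \<sigma> (\<sigma> k) = k" by (simp add: r)
      assume rr: "\<sigma> (\<sigma> k) = k"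
      hence r_eq: "r = \<sigma> k" by (simp add: r)
      have T: "{1..k} - {k, r} = {1..k - 1} - {r}" by auto
      have "r \<in> {1..<k}" using rk by auto
      note bij = bij_betw_relabel[OF this]
      have "entry_moment {1..k - 2} e (e \<circ> perm_flat k \<sigma>) = entry_moment ({1..k - 1} - {r}) e (e \<circ> \<sigma>)"
      proof (rule entry_moment_relabel[OF _ inj bij])
        fix i assume i: "i \<in> {1..k - 1} - {r}"
        show "\<sigma> i \<in> {1..k - 1} - {r}"
        proof -
          have "\<sigma> i \<noteq> k" using i r by auto
          moreover have "\<sigma> i \<noteq> r"
          proof
            assume "\<sigma> i = r"
            hence "\<sigma> i = \<sigma> k" by (simp add: r_eq)
            hence "i = k" using permutes_inj[OF \<sigma>] by (auto dest: injD)
            thus False using i by auto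
          qed
          moreover have "\<sigma> i \<in> {1..k}" using i by (subst in_I) auto
          ultimately show ?thesis by auto
        qed
        have "relabel r i \<in> {1..k - 2}" using bij i by (auto simp: bij_betw_def)
        thus "perm_flat k \<sigma> (relabel r i) = relabel r (\<sigma> i)"
          using bij_betw_inv_into_left[OF bij i] by (simp add: perm_flat_def Let_def r_eq)
      qed (use k in auto)
      thus "entry_moment ({1..k} - {k, r}) e (e \<circ> \<sigma>) = Wg_AIII \<mu> e a (k - 2) (perm_flat k \<sigma>)"
        by (simp only: T Wg_AIII_eq_entry_moment)
    qed simp
    finally show ?thesis using False by simp
  qed
  finally show ?thesis
    unfolding Wg_AIII_sum[OF inj k \<sigma>] .
qed

end

text \<open>For \<open>k \<ge> 2\<close> there are infinitely many paths; \<open>has_sum\<close>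
  asserts unconditional convergence together with the value.\<close>

theorem theorem5p7:
  fixes a b d k :: nat
    and e :: "nat \<Rightarrow> 'n::finite"
    and \<mu> :: "(complex ^ 'n ^ 'n) measure"
    and \<sigma> :: "nat \<Rightarrow> nat"
  assumes "a \<ge> 1" and "b \<ge> 1" and "d = a + b"
    and "bij_betw e {1..d} UNIV"
    and "is_haar_unitary \<mu>"
    and "k \<le> d" and "\<sigma> permutes {1..k}"
  shows "((\<lambda>p. (- 1) ^ solid_length p * of_int (int a - int b) ^ dashed_length p
              * of_nat d powi (- int (path_length p)))
          has_sum Wg_AIII \<mu> e a k \<sigma>) (paths_from (k, \<sigma>))"
proof -
  interpret haar_unitary \<mu> e a by unfold_locales (rule assms)
  define D :: complex where "D = of_int (int a - int b)"
  define X where "X = (\<lambda>(k, \<sigma>). Wg_AIII \<mu> e a k \<sigma>)"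
  have d: "d \<ge> 1" using assms by simp
  have "(path_weight (- 1 / of_nat d) (D / of_nat d) (1 / of_nat d) has_sum X (k, \<sigma>))
      (paths_from (k, \<sigma>))"
  proof (rule has_sum_paths)
    have "norm D = \<bar>real_of_int (int a - int b)\<bar>" unfolding D_def by (rule norm_of_int)
    \<comment> \<open>The difference of \<open>a\<close> and \<open>b\<close> is at most their sum
      in absolute value, so the dashed weight has norm at most 1.\<close>
    also have "\<dots> \<le> d" using assms(3) by linarith
    finally have "norm D \<le> d" .
    thus "norm (D / of_nat d) \<le> 1" using d by (simp add: norm_divide)
    show "norm (- 1 / of_nat d :: complex) \<le> 1 / real d" by (simp add: norm_divide)
    show "norm (1 / of_nat d :: complex) \<le> 1" using d by (simp add: norm_divide)
    \<comment> \<open>The empty product integrates to the total mass of a probability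
      measure.\<close>
    show "X empty_vertex = 1"
      by (simp add: X_def empty_vertex_def Wg_AIII_eq_entry_moment entry_moment_eq prob_space)
  next
    fix k :: nat and \<sigma> assume \<sigma>: "\<sigma> permutes {1..k}" and k: "1 \<le> k" "k \<le> d"
    show "X (k, \<sigma>) = (\<Sum>w\<in>nbrs (k, \<sigma>).
        step_weight (- 1 / of_nat d) (D / of_nat d) (1 / of_nat d) (k, \<sigma>) w * X w)"
    proof -
      have "of_nat d * X (k, \<sigma>) +
        (\<Sum>j\<in>{1..<k}. X (k, Transposition.transpose j k \<circ> \<sigma>)) =
        (if \<sigma> k = k then D * X (k - 1, \<sigma>)
         else if \<sigma> (\<sigma> k) = k then X (k - 2, perm_flat k \<sigma>) else 0)"
        using Wg_AIII_rec[of b, OF _ k(1) _ \<sigma>] assms k by (simp add: X_def D_def)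
      hence "X (k, \<sigma>) = ((if \<sigma> k = k then D * X (k - 1, \<sigma>)
         else if \<sigma> (\<sigma> k) = k then X (k - 2, perm_flat k \<sigma>) else 0) -
        (\<Sum>j\<in>{1..<k}. X (k, Transposition.transpose j k \<circ> \<sigma>))) / of_nat d"
        using d by (simp add: eq_divide_eq mult.commute eq_diff_eq)
      thus ?thesis unfolding nbrs_sum(2)[OF \<sigma> k(1)] by (simp add: diff_divide_distrib)
    qed
  qed (use d assms in auto)
  moreover have "path_weight (- 1 / of_nat d) (D / of_nat d) (1 / of_nat d) =
      (\<lambda>p. (- 1) ^ solid_length p * D ^ dashed_length p * of_nat d powi (- int (path_length p)))"
  proof (rule ext)
    fix p
    \<comment> \<open>Every arrow of any kind carries one factor 1/d, so the power of
      \<open>d\<close> splits over the three counts.\<close>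
    have "(of_nat d :: complex) powi (- int (path_length p)) =
        1 / (of_nat d ^ solid_length p * of_nat d ^ dashed_length p * of_nat d ^ squiggled_length p)"
      by (simp add: power_int_minus path_length_def power_add divide_inverse del: of_nat_add)
    thus "path_weight (- 1 / of_nat d) (D / of_nat d) (1 / of_nat d) p =
      (- 1) ^ solid_length p * D ^ dashed_length p * of_nat d powi (- int (path_length p))"
      unfolding path_weight_def power_divide by simp
  qed
  ultimately show ?thesis by (simp only: X_def D_def prod.case)
qed

end
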